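(* Let $B, C, D$ be unital C*-algebras, let $\delta : B\to D$ and $\gamma : C\to D$ be unital $\ast$-homomorphisms such that either $\gamma$ or $\delta$ is surjective, and let $A := \{(b,c)\in B\oplus C : \delta(b) = \gamma(c)\}$ be the pullback. Then $$gsr(A)\leq \max\{csr(B), csr(C), \mathrm{inj}_0(D)\}.$$ Furthermore, if $K_1(D) = 0$, then $$gsr(A) \leq \max\{gsr(B),gsr(C), \mathrm{inj}_0(D)\}.$$
   Context: For a unital C*-algebra $A$ and $n\ge 1$, $Lg_n(A)$ is the set of left unimodular vectors, i.e. $(a_1,\dots,a_n)\in A^n$ with $Aa_1+\dots+Aa_n=A$, topologized as a subspace of $A^n$. $GL_n(A)$ is the group of invertible elements of $M_n(A)$, acting on $Lg_n(A)$ by left multiplication; $GL_n^0(A)$ is the connected component of the identity, and $GL_0(A)=\{1\}$. The general stable rank $gsr(A)$ is the least $n\ge 1$ such that $GL_m(A)$ acts transitively on $Lg_m(A)$ for all $m\ge n$ (equivalently: for all $m\ge n$, every projective right $A$-module $P$ with $P\oplus A\cong A^m$ satisfies $P\cong A^{m-1}$). The connected stable rank $csr(A)$ is the least $n\ge 1$ such that $GL_m^0(A)$ acts transitively on $Lg_m(A)$ for all $m\ge n$ (equivalently, $Lg_m(A)$ is connected for all $m\ge n$). $\mathrm{inj}_0(D)$ is the least $n\ge 1$ such that the map $\pi_0(GL_{m-1}(D))\to\pi_0(GL_m(D))$ induced by $a\mapsto \begin{pmatrix} a & 0\\ 0& 1\end{pmatrix}$ is injective for all $m\ge n$. Each is $+\infty$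 if no such $n$ exists. *)

theory Defs
  imports "HOL-Analysis.Analysis" "HOL-Library.Extended_Nat" "HOL-Algebra.Group"
begin

section \<open>Unital C*-algebras and their homomorphisms\<close>

text \<open>
  The class is built on \<^class>\<open>monoid_mult\<close> and not on the library's
  \<open>real_normed_algebra_1\<close>, because the latter demands \<open>0 \<noteq> 1\<close>; here the zero C*-algebra
  is admitted. The real scalar multiplication of the underlying Banach space is tied to the complex
  one by \<open>scaleR_scaleC\<close>.
\<close>

class unital_cstar_algebra = real_normed_algebra + monoid_mult + banach +
  fixes scaleC :: "complex \<Rightarrow> 'a \<Rightarrow> 'a"
    and star :: "'a \<Rightarrow> 'a"
  assumes scaleR_scaleC: "scaleR r x = scaleC (complex_of_real r) x"
    and scaleC_add_right: "scaleC \<alpha> (x + y) = scaleC \<alpha> x + scaleC \<alpha> y"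
    and scaleC_add_left: "scaleC (\<alpha> + \<beta>) x = scaleC \<alpha> x + scaleC \<beta> x"
    and scaleC_scaleC: "scaleC \<alpha> (scaleC \<beta> x) = scaleC (\<alpha> * \<beta>) x"
    and mult_scaleC_left: "scaleC \<alpha> x * y = scaleC \<alpha> (x * y)"
    and mult_scaleC_right: "x * scaleC \<alpha> y = scaleC \<alpha> (x * y)"
    and norm_scaleC: "norm (scaleC \<alpha> x) = cmod \<alpha> * norm x"
    and star_star: "star (star x) = x"
    and star_add: "star (x + y) = star x + star y"
    and star_mult: "star (x * y) = star y * star x"
    and star_scaleC: "star (scaleC \<alpha> x) = scaleC (cnj \<alpha>) (star x)"
    and norm_star_mult_self: "norm (star x * x) = (norm x)\<^sup>2"

definition unital_star_hom ::
    "('a::unital_cstar_algebra \<Rightarrow> 'b::unital_cstar_algebra) \<Rightarrow> bool" where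
  "unital_star_hom f \<longleftrightarrow>
     (\<forall>x y. f (x + y) = f x + f y) \<and>
     (\<forall>\<alpha> x. f (scaleC \<alpha> x) = scaleC \<alpha> (f x)) \<and>
     (\<forall>x y. f (x * y) = f x * f y) \<and>
     (\<forall>x. f (star x) = star (f x)) \<and>
     f 1 = 1"


section \<open>The direct sum and the pullback\<close>

text \<open>
  Componentwise ring structure on pairs. The library norm on pairs is Euclidean, hence not a
  C*-norm, so the pair type is not made an instance of \<^class>\<open>unital_cstar_algebra\<close>. The C*-norm
  of the direct sum is the maximum norm; it plays no role below, since the general stable rank
  depends on the ring structure only.
\<close>

instantiation prod :: (times, times) times
begin
definition times_prod_def: "x * y = (fst x * fst y, snd x * snd y)"
instance ..
end

instantiation prod :: (one, one) one
begin
definition one_prod_def: "1 = (1, 1)"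
instance ..
end

instance prod :: (semigroup_mult, semigroup_mult) semigroup_mult
  by standard (simp add: times_prod_def mult.assoc)

instance prod :: (ring, ring) ring
  by standard (simp_all add: times_prod_def plus_prod_def algebra_simps)

instance prod :: (monoid_mult, monoid_mult) monoid_mult
  by standard (simp_all add: times_prod_def one_prod_def algebra_simps)

definition pullback :: "('b \<Rightarrow> 'd) \<Rightarrow> ('c \<Rightarrow> 'd) \<Rightarrow> ('b \<times> 'c) set" where
  "pullback \<delta> \<gamma> = {(b, c). \<delta> b = \<gamma> c}"

lemma pullback_unital_subring:
  assumes "unital_star_hom \<delta>" "unital_star_hom \<gamma>"
  shows "1 \<in> pullback \<delta> \<gamma>"
    and "\<lbrakk>x \<in> pullback \<delta> \<gamma>; y \<in> pullback \<delta> \<gamma>\<rbrakk> \<Longrightarrow> x + y \<in> pullback \<delta> \<gamma>"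
    and "x \<in> pullback \<delta> \<gamma> \<Longrightarrow> - x \<in> pullback \<delta> \<gamma>"
    and "\<lbrakk>x \<in> pullback \<delta> \<gamma>; y \<in> pullback \<delta> \<gamma>\<rbrakk> \<Longrightarrow> x * y \<in> pullback \<delta> \<gamma>"
proof -
  have minus: "f (- z) = - f z" if "unital_star_hom f"
    for f :: "'x::unital_cstar_algebra \<Rightarrow> 'y::unital_cstar_algebra" and z
  proof -
    interpret additive f
      using that by unfold_locales (simp add: unital_star_hom_def)
    show ?thesis by (rule minus)
  qed
  show "x \<in> pullback \<delta> \<gamma> \<Longrightarrow> - x \<in> pullback \<delta> \<gamma>"
    by (auto simp: pullback_def minus[OF assms(1)] minus[OF assms(2)])
qed (use assms in \<open>auto simp: pullback_def unital_star_hom_def times_prod_def one_prod_def\<close>)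


section \<open>Vectors and matrices\<close>

text \<open>
  Throughout, \<open>S\<close> is (the carrier of) a unital subring of the ambient type; \<open>S = UNIV\<close> gives the
  whole algebra. Vectors of length \<open>n\<close> and \<open>n \<times> n\<close> matrices are functions on indices
  \<open>0, \<dots>, n - 1\<close>, extended by \<open>0\<close>. Thus the product topology on the function type induces the usual
  topology of \<open>S\<^sup>n\<close> and \<open>M\<^sub>n(S)\<close>. For \<open>n = 0\<close> there is exactly one matrix, so that
  \<open>GL 0 S\<close> is the trivial group.
\<close>

definition Vec :: "nat \<Rightarrow> 'a::zero set \<Rightarrow> (nat \<Rightarrow> 'a) set" where
  "Vec n S = {a. (\<forall>i<n. a i \<in> S) \<and> (\<forall>i\<ge>n. a i = 0)}"

definition Mat :: "nat \<Rightarrow> 'a::zero set \<Rightarrow> (nat \<Rightarrow> nat \<Rightarrow> 'a) set" where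
  "Mat n S = {M. (\<forall>i<n. \<forall>j<n. M i j \<in> S) \<and> (\<forall>i j. i \<ge> n \<or> j \<ge> n \<longrightarrow> M i j = 0)}"

definition mat_mult :: "nat \<Rightarrow> (nat \<Rightarrow> nat \<Rightarrow> 'a::ring) \<Rightarrow> (nat \<Rightarrow> nat \<Rightarrow> 'a) \<Rightarrow> nat \<Rightarrow> nat \<Rightarrow> 'a" where
  "mat_mult n M N = (\<lambda>i j. \<Sum>k<n. M i k * N k j)"

definition mat_one :: "nat \<Rightarrow> nat \<Rightarrow> nat \<Rightarrow> 'a::{ring, monoid_mult}" where
  "mat_one n = (\<lambda>i j. if i = j \<and> i < n then 1 else 0)"

definition mat_vec :: "nat \<Rightarrow> (nat \<Rightarrow> nat \<Rightarrow> 'a::ring) \<Rightarrow> (nat \<Rightarrow> 'a) \<Rightarrow> nat \<Rightarrow> 'a" where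
  "mat_vec n M a = (\<lambda>i. \<Sum>j<n. M i j * a j)"

definition GL :: "nat \<Rightarrow> 'a::{ring, monoid_mult} set \<Rightarrow> (nat \<Rightarrow> nat \<Rightarrow> 'a) set" where
  "GL n S = {M \<in> Mat n S. \<exists>N \<in> Mat n S. mat_mult n M N = mat_one n \<and> mat_mult n N M = mat_one n}"

definition GL0 :: "nat \<Rightarrow> 'a::{topological_space, ring, monoid_mult} set \<Rightarrow> (nat \<Rightarrow> nat \<Rightarrow> 'a) set" where
  "GL0 n S = connected_component_set (GL n S) (mat_one n)"

definition Lg :: "nat \<Rightarrow> 'a::{ring, monoid_mult} set \<Rightarrow> (nat \<Rightarrow> 'a) set" where
  "Lg n S = {a \<in> Vec n S. {\<Sum>i<n. x i * a i | x. x \<in> Vec n S} = S}"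

text \<open>For \<open>k \<ge> n\<close>, \<open>mat_pad n k M\<close> is the block matrix \<open>diag (M, 1\<^bsub>k - n\<^esub>)\<close>.\<close>

definition mat_pad :: "nat \<Rightarrow> nat \<Rightarrow> (nat \<Rightarrow> nat \<Rightarrow> 'a::{ring, monoid_mult}) \<Rightarrow> nat \<Rightarrow> nat \<Rightarrow> 'a" where
  "mat_pad n k M = (\<lambda>i j. if i = j \<and> n \<le> i \<and> i < k then 1 else M i j)"


section \<open>Stable ranks\<close>

definition transitive_on :: "nat \<Rightarrow> (nat \<Rightarrow> nat \<Rightarrow> 'a::ring) set \<Rightarrow> (nat \<Rightarrow> 'a) set \<Rightarrow> bool" where
  "transitive_on n G X \<longleftrightarrow> (\<forall>a\<in>X. \<forall>b\<in>X. \<exists>g\<in>G. mat_vec n g a = b)"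

text \<open>The infimum of the empty set in \<^typ>\<open>enat\<close> is \<open>\<infinity>\<close>.\<close>

definition gsr :: "'a::{ring, monoid_mult} set \<Rightarrow> enat" where
  "gsr S = Inf {enat n | n. n \<ge> 1 \<and> (\<forall>m\<ge>n. transitive_on m (GL m S) (Lg m S))}"

definition csr :: "'a::{topological_space, ring, monoid_mult} set \<Rightarrow> enat" where
  "csr S = Inf {enat n | n. n \<ge> 1 \<and> (\<forall>m\<ge>n. transitive_on m (GL0 m S) (Lg m S))}"


section \<open>Path components and \<open>K\<^sub>1\<close>\<close>

definition pi0 :: "'a::topological_space set \<Rightarrow> 'a set set" where
  "pi0 X = path_components_of (top_of_set X)"

text \<open>
  For \<open>f\<close> continuous from \<open>X\<close> to \<open>Y\<close> and \<open>P \<in> pi0 X\<close>, all sets in the union coincide, so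
  this is the component of \<open>Y\<close> containing the image of \<open>P\<close>.
\<close>

definition pi0_map ::
    "'b::topological_space set \<Rightarrow> ('a::topological_space \<Rightarrow> 'b) \<Rightarrow> 'a set \<Rightarrow> 'b set" where
  "pi0_map Y f P = (\<Union>u\<in>P. path_component_set Y (f u))"

definition inj0 :: "'a::{topological_space, ring, monoid_mult} set \<Rightarrow> enat" where
  "inj0 S = Inf {enat n | n. n \<ge> 1 \<and>
     (\<forall>m\<ge>n. inj_on (pi0_map (GL m S) (mat_pad (m - 1) m)) (pi0 (GL (m - 1) S)))}"

text \<open>
  \<open>K1 S\<close> is the direct limit of the groups \<open>\<pi>\<^sub>0(GL\<^sub>n(S))\<close> along \<open>M \<mapsto> diag (M, 1)\<close>: invertible
  matrices of all sizes, two of them being identified when they become homotopic in some common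
  larger size.
\<close>

definition K1_rel ::
    "'a::{topological_space, ring, monoid_mult} set \<Rightarrow> (nat \<times> (nat \<Rightarrow> nat \<Rightarrow> 'a)) rel" where
  "K1_rel S = {((n, u), (m, v)). u \<in> GL n S \<and> v \<in> GL m S \<and>
     (\<exists>k\<ge>max n m. path_component (GL k S) (mat_pad n k u) (mat_pad m k v))}"

definition K1 ::
    "'a::{topological_space, ring, monoid_mult} set \<Rightarrow> (nat \<times> (nat \<Rightarrow> nat \<Rightarrow> 'a)) set monoid" where
  "K1 S = \<lparr>
     carrier = (SIGMA n:UNIV. GL n S) // K1_rel S,
     mult = (\<lambda>X Y. \<Union>(n, u)\<in>X. \<Union>(m, v)\<in>Y.
       K1_rel S `` {(max n m, mat_mult (max n m) (mat_pad n (max n m) u) (mat_pad m (max n m) v))}),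
     one = K1_rel S `` {(0, mat_one 0)}\<rparr>"

end

theory Submission
  imports Defs
begin

text \<open>
  Let \<open>e\<close> be the last unit vector and \<open>a\<close> a left unimodular vector over the pullback. Choose invertible
  matrices \<open>M\<close> over \<open>B\<close> and \<open>N\<close> over \<open>C\<close> which carry the two components of \<open>a\<close> to \<open>e\<close>. Then
  \<open>\<delta>(M) \<gamma>(N)\<^sup>-\<^sup>1\<close> fixes \<open>e\<close>, so it is block lower triangular with diagonal blocks \<open>g\<close> and \<open>1\<close>. By the
  hypothesis on \<open>inj\<^sub>0(D)\<close>, together with \<open>M, N \<in> GL\<^sup>0\<close> or with \<open>K\<^sub>1(D) = 0\<close>, the block \<open>g\<close> is
  connected to \<open>1\<close> in \<open>GL\<^sub>n\<^sub>-\<^sub>1(D)\<close>. Such a \<open>g\<close> lifts along the surjective map, and correcting \<open>N\<close>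
  (or \<open>M\<close>) by the lift makes the two matrices agree over \<open>D\<close>.

  Automatic continuity of \<open>*\<close>-homomorphisms is avoided. A homomorphism maps segments to
  segments, which suffices for paths. For lifting, Gaussian elimination reduces a matrix near \<open>1\<close> to
  its diagonal entries, and an element near \<open>1\<close> is a product of real scalars and of
  factors \<open>1 + ih\<close> with \<open>h\<close> self-adjoint, which lift because self-adjoint elements have real spectrum.
\<close>

section \<open>Lifting invertible elements near one\<close>

lemma left_right_inverse_eq:
  fixes x :: "'a::monoid_mult"
  assumes "y * x = 1" "x * z = 1" shows "y = z"
  by (metis assms mult.assoc mult_1_left mult_1_right)

lemma star_one [simp]: "star (1::'a::unital_cstar_algebra) = 1"
  using star_mult[of "star 1" "1::'a"] by (simp add: star_star)

text \<open>Only an inequality can be claimed: in the zero algebra \<open>1 = 0\<close> has norm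
  0.\<close>

lemma norm_one_le: "norm (1::'a::unital_cstar_algebra) \<le> 1"
proof -
  have "norm (1::'a) = (norm (1::'a))\<^sup>2" using norm_star_mult_self[of "1::'a"] by simp
  then show ?thesis by (metis order_refl power2_eq_square mult_cancel_right1 zero_le_one)
qed

text \<open>Contractions take the place of the Neumann series: the fixed points of y -> 1 + x y and
  z -> 1 + z x are a right and a left inverse of \<open>1 - x\<close>, hence equal.\<close>

lemma one_minus_invertible:
  fixes x :: "'a::unital_cstar_algebra"
  assumes "norm x < 1"
  obtains y where "(1 - x) * y = 1" "y * (1 - x) = 1"
proof -
  have "dist (1 + x * y) (1 + x * z) \<le> norm x * dist y z" for y z
    by (simp add: dist_norm norm_mult_ineq flip: right_diff_distrib)
  then obtain y where y: "1 + x * y = y"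
    using banach_fix_type[OF norm_ge_zero assms, of "\<lambda>y. 1 + x * y"] by blast
  have "dist (1 + y * x) (1 + z * x) \<le> norm x * dist y z" for y z
    by (simp add: dist_norm norm_mult_ineq mult.commute[of "norm x"] flip: left_diff_distrib)
  then obtain z where z: "1 + z * x = z"
    using banach_fix_type[OF norm_ge_zero assms, of "\<lambda>z. 1 + z * x"] by blast
  have "(1 - x) * y = 1" "z * (1 - x) = 1"
    using y z by (simp_all add: algebra_simps)
  with left_right_inverse_eq that show ?thesis by metis
qed

lemma star_scaleR: "star (r *\<^sub>R x) = r *\<^sub>R star (x::'a::unital_cstar_algebra)"
  by (simp add: scaleR_scaleC star_scaleC)

lemma additive_star: "Modules.additive (star :: 'a::unital_cstar_algebra \<Rightarrow> 'a)"
  by unfold_locales (rule star_add)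

lemma additive_scaleC: "Modules.additive (scaleC \<alpha> :: 'a::unital_cstar_algebra \<Rightarrow> 'a)"
  by unfold_locales (rule scaleC_add_right)

lemmas star_minus = Modules.additive.minus[OF additive_star]
  and star_diff = Modules.additive.diff[OF additive_star]
  and scaleC_minus_right = Modules.additive.minus[OF additive_scaleC]
  and scaleC_diff_right = Modules.additive.diff[OF additive_scaleC]

lemma scaleC_of_real: "scaleC (complex_of_real r) x = r *\<^sub>R x"
  by (simp add: scaleR_scaleC)

lemma scaleC_scaleR: "scaleC \<alpha> (r *\<^sub>R x) = r *\<^sub>R scaleC \<alpha> x"
  by (simp add: scaleR_scaleC scaleC_scaleC mult.commute)

lemma scaleC_i_i: "scaleC \<i> (scaleC \<i> x) = - x"
  using scaleC_of_real[of "-1" x] by (simp add: scaleC_scaleC)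

lemma star_scaleC_i: "star (scaleC \<i> x) = - scaleC \<i> (star x)"
  using scaleC_scaleC[of "of_real (-1)" \<i> "star x"] scaleC_of_real[of "-1" "scaleC \<i> (star x)"]
  by (simp add: star_scaleC)

lemma norm_star: "norm (star x) = norm (x::'a::unital_cstar_algebra)"
proof -
  have le: "norm x \<le> norm (star x)" for x :: 'a
  proof (cases "x = 0")
    case False
    have "norm x * norm x \<le> norm (star x) * norm x"
      using norm_mult_ineq[of "star x" x] by (simp add: norm_star_mult_self power2_eq_square)
    with False show ?thesis by simp
  qed auto
  from le[of x] le[of "star x"] show ?thesis by (simp add: star_star)
qed

text \<open>Arens' trick: write \<open>1 + ih\<close> as \<open>(1 + l) - (l - ih)\<close> with \<open>l\<close> real and large; the C*-identity
  gives \<open>\<parallel>l - ih\<parallel>\<^sup>2 \<le> l\<^sup>2 + \<parallel>h\<parallel>\<^sup>2 < (1 + l)\<^sup>2\<close>.\<close>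

lemma one_plus_i_selfadjoint_invertible:
  fixes h :: "'a::unital_cstar_algebra"
  assumes "star h = h"
  obtains y where "(1 + scaleC \<i> h) * y = 1" "y * (1 + scaleC \<i> h) = 1"
proof -
  define l where "l = (norm h)\<^sup>2"
  define w where "w = l *\<^sub>R 1 - scaleC \<i> h"
  have l: "l \<ge> 0" by (simp add: l_def)
  have "star w * w = (l *\<^sub>R 1 + scaleC \<i> h) * (l *\<^sub>R 1 - scaleC \<i> h)"
    by (simp add: w_def star_diff star_scaleR star_scaleC_i assms)
  also have "\<dots> = (l * l) *\<^sub>R 1 + h * h"
    by (simp add: algebra_simps mult_scaleC_left mult_scaleC_right scaleC_scaleR scaleC_i_i
        scaleC_add_right scaleC_diff_right)
  finally have "(norm w)\<^sup>2 = norm ((l * l) *\<^sub>R 1 + h * h)"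
    by (metis norm_star_mult_self)
  also have "\<dots> \<le> l * l * norm (1::'a) + norm h * norm h"
    by (rule order_trans[OF norm_triangle_ineq]) (use l in \<open>auto intro!: add_mono norm_mult_ineq\<close>)
  also have "\<dots> \<le> l * l * 1 + l"
    by (intro add_mono mult_left_mono norm_one_le) (auto simp: l_def power2_eq_square)
  also have "\<dots> < (1 + l)\<^sup>2"
    using l by (simp add: power2_eq_square algebra_simps)
  finally have "norm w < 1 + l"
    using l power_less_imp_less_base[of "norm w" 2 "1 + l"] by simp
  then have "norm ((1 / (1 + l)) *\<^sub>R w) < 1" using l by (simp add: field_simps)
  from one_minus_invertible[OF this] obtain y
    where y: "(1 - (1 / (1 + l)) *\<^sub>R w) * y = 1" "y * (1 - (1 / (1 + l)) *\<^sub>R w) = 1" by blast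
  have "1 + scaleC \<i> h = (1 + l) *\<^sub>R 1 - w"
    by (simp add: w_def algebra_simps)
  also have "\<dots> = (1 + l) *\<^sub>R (1 - (1 / (1 + l)) *\<^sub>R w)"
    using l by (simp add: scaleR_right_diff_distrib)
  finally have eq: "1 + scaleC \<i> h = (1 + l) *\<^sub>R (1 - (1 / (1 + l)) *\<^sub>R w)" .
  show thesis
    using l by (intro that[of "(1 / (1 + l)) *\<^sub>R y"]) (simp_all add: eq y)
qed

text \<open>The equation amounts to u = (y - u u) / 2. Its right-hand side maps the self-adjoint
  elements of norm at most 1/2 to themselves and contracts them, which replaces functional calculus.
  The bound on \<open>norm u\<close> leaves room for taking a second root.\<close>

lemma selfadjoint_sqrt_near_one:
  fixes y :: "'a::unital_cstar_algebra"
  assumes "star y = y" "norm y \<le> 1/4"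
  obtains u where "star u = u" "norm u \<le> norm y" "(1 + u) * (1 + u) = 1 + y"
proof -
  let ?S = "{u::'a. star u = u \<and> norm u \<le> 1/2}"
  have cont: "continuous_on UNIV (star :: 'a \<Rightarrow> 'a)"
    by (rule continuous_onI) (metis UNIV_I dist_norm norm_star star_diff order_less_imp_le)
  have closed: "closed ?S"
    by (intro closed_Collect_conj closed_Collect_eq closed_Collect_le cont continuous_intros)
  have sq: "norm (u * u) \<le> 1/2 * norm u" if "norm u \<le> 1/2" for u :: 'a
    using norm_mult_ineq[of u u] mult_right_mono[OF that, of "norm u"] by simp
  have "\<exists>!u\<in>?S. (1/2) *\<^sub>R (y - u * u) = u"
  proof (rule Banach_fix[where c = "1/2"])
    show "complete ?S" using closed by (simp add: complete_eq_closed)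
    show "?S \<noteq> {}" using star_scaleR[of 0 "0::'a"] by (auto intro!: exI[of _ 0])
    show "(\<lambda>u. (1/2) *\<^sub>R (y - u * u)) ` ?S \<subseteq> ?S"
    proof (safe)
      fix u :: 'a assume u: "star u = u" "norm u \<le> 1/2"
      show "star ((1/2) *\<^sub>R (y - u * u)) = (1/2) *\<^sub>R (y - u * u)"
        by (simp add: star_scaleR star_diff star_mult u assms)
      have "norm (y - u * u) \<le> norm y + norm (u * u)" by (rule norm_triangle_ineq4)
      then show "norm ((1/2) *\<^sub>R (y - u * u)) \<le> 1/2" using sq[of u] u assms by simp
    qed
    fix u v :: 'a assume "u \<in> ?S" "v \<in> ?S"
    then have uv: "norm u \<le> 1/2" "norm v \<le> 1/2" by auto
    have "v * v - u * u = v * (v - u) + (v - u) * u" by (simp add: algebra_simps)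
    then have "norm (v * v - u * u) \<le> norm v * norm (v - u) + norm (v - u) * norm u"
      by (simp add: norm_triangle_le[OF add_mono[OF norm_mult_ineq norm_mult_ineq]])
    also have "\<dots> \<le> 1/2 * norm (v - u) + norm (v - u) * (1/2)"
      by (intro add_mono mult_mono uv) auto
    finally have "norm (v * v - u * u) \<le> norm (u - v)" by (simp add: norm_minus_commute)
    then show "dist ((1/2) *\<^sub>R (y - u * u)) ((1/2) *\<^sub>R (y - v * v)) \<le> 1/2 * dist u v"
      by (simp add: dist_norm flip: scaleR_diff_right)
  qed auto
  then obtain u where u: "star u = u" "norm u \<le> 1/2" and fix_u: "(1/2) *\<^sub>R (y - u * u) = u"
    by blast
  from fix_u have "2 *\<^sub>R ((1/2) *\<^sub>R (y - u * u)) = 2 *\<^sub>R u" by simp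
  then have two: "y - u * u = u + u" by (simp add: scaleR_2)
  have "norm (u + u) \<le> norm y + norm (u * u)" using norm_triangle_ineq4[of y "u * u"] by (simp add: two)
  moreover have "norm (u + u) = 2 * norm u" by (simp flip: scaleR_2)
  ultimately have "norm u \<le> norm y" using sq[OF u(2)] norm_ge_zero[of u] by linarith
  moreover have "(1 + u) * (1 + u) = 1 + y" using two by (simp add: algebra_simps)
  ultimately show thesis using that u by blast
qed

section \<open>Units that lift along a homomorphism\<close>

lemma
  assumes "unital_star_hom f"
  shows hom_add: "f (x + y) = f x + f y"
    and hom_mult: "f (x * y) = f x * f y"
    and hom_scaleC: "f (scaleC \<alpha> x) = scaleC \<alpha> (f x)"
    and hom_scaleR: "f (r *\<^sub>R x) = r *\<^sub>R f x"
    and hom_star: "f (star x) = star (f x)"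
    and hom_one: "f 1 = 1"
    and hom_zero: "f 0 = 0"
    and hom_sum: "f (sum g I) = (\<Sum>i\<in>I. f (g i))"
proof -
  interpret additive f using assms by unfold_locales (simp add: unital_star_hom_def)
  show "f 0 = 0" "f (sum g I) = (\<Sum>i\<in>I. f (g i))"
    by (rule zero sum)+
qed (use assms in \<open>auto simp: unital_star_hom_def scaleR_scaleC\<close>)

text \<open>A unit of the target need not have an invertible preimage even under a surjection, so
  liftability is tracked as a property of its own. It is closed under products and nonzero real
  factors.\<close>

definition lifts_to_unit :: "('a::monoid_mult \<Rightarrow> 'b) \<Rightarrow> 'b \<Rightarrow> bool" where
  "lifts_to_unit f d \<longleftrightarrow> (\<exists>u v. f u = d \<and> u * v = 1 \<and> v * u = 1)"

lemma lifts_to_unit_mult: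
  assumes "unital_star_hom f" "lifts_to_unit f d" "lifts_to_unit f e"
  shows "lifts_to_unit f (d * e)"
proof -
  obtain u v u' v' where "f u = d" "u * v = 1" "v * u = 1" "f u' = e" "u' * v' = 1" "v' * u' = 1"
    using assms by (auto simp: lifts_to_unit_def)
  then have "f (u * u') = d * e" "(u * u') * (v' * v) = 1" "(v' * v) * (u * u') = 1"
    using hom_mult[OF assms(1)] by (simp_all, (metis mult.assoc mult_1_left)+)
  then show ?thesis unfolding lifts_to_unit_def by blast
qed

lemma lifts_to_unit_scaleR:
  assumes "unital_star_hom f" "lifts_to_unit f d" "r \<noteq> 0"
  shows "lifts_to_unit f (r *\<^sub>R d)"
proof -
  obtain u v where "f u = d" "u * v = 1" "v * u = 1"
    using assms by (auto simp: lifts_to_unit_def)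
  then show ?thesis unfolding lifts_to_unit_def
    using \<open>r \<noteq> 0\<close>
    by (intro exI[of _ "r *\<^sub>R u"] exI[of _ "(1 / r) *\<^sub>R v"]) (simp add: hom_scaleR[OF assms(1)])
qed

text \<open>Any preimage \<open>x\<close> of \<open>h\<close> can be replaced by its real part
  \<open>w\<close>, which is self-adjoint and still maps to \<open>h\<close>; then 1 + iw is
  invertible before \<open>f\<close> is applied.\<close>

lemma lifts_to_unit_one_plus_i:
  assumes f: "unital_star_hom f" "surj f" and h: "star h = h"
  shows "lifts_to_unit f (1 + scaleC \<i> h)"
proof -
  obtain x where x: "f x = h" using \<open>surj f\<close> by (metis surj_def)
  define w where "w = (1/2) *\<^sub>R (x + star x)"
  have "star w = w" by (simp add: w_def star_scaleR star_add star_star add.commute)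
  then obtain y where y: "(1 + scaleC \<i> w) * y = 1" "y * (1 + scaleC \<i> w) = 1"
    using one_plus_i_selfadjoint_invertible by blast
  have "f w = h"
    by (simp add: w_def hom_scaleR[OF f(1)] hom_add[OF f(1)] hom_star[OF f(1)] x h)
  then have "f (1 + scaleC \<i> w) = 1 + scaleC \<i> h"
    by (simp add: hom_add[OF f(1)] hom_scaleC[OF f(1)] hom_one[OF f(1)])
  with y show ?thesis unfolding lifts_to_unit_def by blast
qed

text \<open>Lifting exponentials would need continuity of \<open>f\<close>. Instead, for self-adjoint \<open>s\<close> near \<open>1\<close>,
  \<open>2s = 1 + h\<^sup>2 = (1 + ih)(1 - ih)\<close>; a general element \<open>d = s\<^sup>2 + ib\<close> near \<open>1\<close> is
  \<open>s (1 + i s\<^sup>-\<^sup>1 b s\<^sup>-\<^sup>1) s\<close>.\<close>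

lemma lifts_to_unit_near_one:
  fixes f :: "'a::unital_cstar_algebra \<Rightarrow> 'b::unital_cstar_algebra"
  assumes f: "unital_star_hom f" "surj f" and d: "norm (d - 1) \<le> 1/8"
  shows "lifts_to_unit f d"
proof -
  \<comment> \<open>Here d = 1 + y + ib with \<open>y\<close> and \<open>b\<close> self-adjoint: the
    real part of \<open>d - 1\<close> and the imaginary part of \<open>d\<close>.\<close>
  define y where "y = (1/2) *\<^sub>R ((d - 1) + star (d - 1))"
  define b where "b = - ((1/2) *\<^sub>R scaleC \<i> (d - star d))"
  have "star y = y" by (simp add: y_def star_scaleR star_add star_star add.commute)
  have "star b = b"
    by (simp add: b_def star_minus star_scaleR star_scaleC_i star_diff star_star
        scaleC_minus_right scaleC_diff_right)
  have ib: "scaleC \<i> b = (1/2) *\<^sub>R (d - star d)"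
    by (simp add: b_def scaleC_scaleR scaleC_minus_right scaleC_i_i flip: scaleR_minus_right)
  have "norm y \<le> norm (d - 1)"
    using norm_triangle_ineq[of "d - 1" "star (d - 1)"] by (simp add: y_def norm_star)
  with d have "norm y \<le> 1/8" by simp
  then obtain u where u: "star u = u" "norm u \<le> norm y" "(1 + u) * (1 + u) = 1 + y"
    using selfadjoint_sqrt_near_one[OF \<open>star y = y\<close>] by auto
  \<comment> \<open>A second root, now of 1 + 2u = 2s - 1, yields the \<open>h\<close> with 1 + hh =
    2s. The radius 1/8 is chosen so that \<open>2 *\<^sub>R u\<close> still has norm at most
    1/4.\<close>
  have "star (2 *\<^sub>R u) = 2 *\<^sub>R u" "norm (2 *\<^sub>R u) \<le> 1/4"
    using u \<open>norm y \<le> 1/8\<close> by (simp_all add: star_scaleR)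
  then obtain v where v: "star v = v" "(1 + v) * (1 + v) = 1 + 2 *\<^sub>R u"
    using selfadjoint_sqrt_near_one by blast
  define s where "s = 1 + u"
  define h where "h = 1 + v"
  have "star h = h" by (simp add: h_def star_add v)
  have "star (- h) = - h" by (simp add: star_minus \<open>star h = h\<close>)
  have "(1/2) *\<^sub>R ((1 + scaleC \<i> h) * (1 + scaleC \<i> (- h))) = (1/2) *\<^sub>R (1 + h * h)"
    by (simp add: algebra_simps mult_scaleC_left mult_scaleC_right scaleC_i_i scaleC_minus_right
        scaleC_add_right)
  also have "\<dots> = s"
  proof -
    have "1 + h * h = s + s" unfolding h_def v(2) s_def by (simp add: scaleR_2)
    then show ?thesis by (simp only: scaleR_half_double)
  qed
  finally have s: "lifts_to_unit f s"
    using lifts_to_unit_one_plus_i[OF f \<open>star h = h\<close>] lifts_to_unit_one_plus_i[OF f \<open>star (- h) = - h\<close>]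
      lifts_to_unit_scaleR[OF f(1)] lifts_to_unit_mult[OF f(1)] by fastforce
  then obtain p q where "f p = s" "p * q = 1" "q * p = 1"
    by (auto simp: lifts_to_unit_def)
  then have st: "s * f q = 1" "f q * s = 1"
    using hom_mult[OF f(1)] hom_one[OF f(1)] by metis+
  have "star s = s" by (simp add: s_def star_add u)
  \<comment> \<open>The adjoint of \<open>f q\<close> is again a left inverse of the self-adjoint
    \<open>s\<close>, so \<open>f q\<close> is self-adjoint, and with it
    \<open>f q * b * f q\<close>.\<close>
  have "star (f q) * s = 1" using star_mult[of s "f q"] st \<open>star s = s\<close> by simp
  then have "star (f q) = f q" using st left_right_inverse_eq by blast
  have "star (f q * b * f q) = f q * b * f q"
    by (simp add: star_mult \<open>star b = b\<close> \<open>star (f q) = f q\<close> mult.assoc)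
  then have "lifts_to_unit f (s * (1 + scaleC \<i> (f q * b * f q)) * s)"
    using f s lifts_to_unit_mult lifts_to_unit_one_plus_i by metis
  moreover have "s * (1 + scaleC \<i> (f q * b * f q)) * s = s * s + scaleC \<i> ((s * f q) * b * (f q * s))"
    by (simp add: algebra_simps mult_scaleC_left mult_scaleC_right)
  moreover have "\<dots> = 1 + y + scaleC \<i> b" using u by (simp add: st flip: s_def)
  moreover have "\<dots> = d"
  proof -
    have "y + scaleC \<i> b = (1/2) *\<^sub>R ((d - 1 + star (d - 1)) + (d - star d))"
      by (simp only: ib y_def scaleR_add_right)
    also have "(d - 1 + star (d - 1)) + (d - star d) = (d - 1) + (d - 1)" by (simp add: star_diff)
    also have "(1/2) *\<^sub>R \<dots> = d - 1" by (rule scaleR_half_double)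
    finally show ?thesis by (simp add: add.assoc)
  qed
  ultimately show ?thesis by simp
qed

section \<open>Invertible matrices\<close>

lemma mat_mult_assoc: "mat_mult n (mat_mult n L M) N = mat_mult n L (mat_mult n M N)"
  unfolding mat_mult_def sum_distrib_left sum_distrib_right mult.assoc
  by (intro ext sum.swap)

lemma mat_vec_mat_mult: "mat_vec n (mat_mult n M N) a = mat_vec n M (mat_vec n N a)"
  unfolding mat_mult_def mat_vec_def sum_distrib_left sum_distrib_right mult.assoc
  by (intro ext sum.swap)

lemma mat_one_eq_if: "mat_one n i j * x = (if i = j then if i < n then x else 0 else 0)"
    "x * mat_one n i j = (if i = j then if i < n then x else 0 else 0)"
  by (auto simp: mat_one_def)

lemma mat_mult_one_left: "M \<in> Mat n S \<Longrightarrow> mat_mult n (mat_one n) M = M"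
  by (auto simp: mat_mult_def mat_one_eq_if Mat_def fun_eq_iff not_less)

lemma mat_mult_one_right: "M \<in> Mat n S \<Longrightarrow> mat_mult n M (mat_one n) = M"
  by (auto simp: mat_mult_def mat_one_eq_if Mat_def fun_eq_iff not_less)

lemma mat_vec_one: "a \<in> Vec n S \<Longrightarrow> mat_vec n (mat_one n) a = a"
  by (auto simp: mat_vec_def mat_one_eq_if Vec_def fun_eq_iff not_less)

lemma Mat_outside: "M \<in> Mat n S \<Longrightarrow> n \<le> i \<or> n \<le> j \<Longrightarrow> M i j = 0"
  by (auto simp: Mat_def)

lemma mat_mult_Mat:
  assumes "0 \<in> S" "\<And>x y. x \<in> S \<Longrightarrow> y \<in> S \<Longrightarrow> x + y \<in> S" "\<And>x y. x \<in> S \<Longrightarrow> y \<in> S \<Longrightarrow> x * y \<in> S"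
    and "M \<in> Mat n S" "N \<in> Mat n S"
  shows "mat_mult n M N \<in> Mat n S"
proof -
  have sum: "sum f I \<in> S" if "\<And>i. i \<in> I \<Longrightarrow> f i \<in> S" for f :: "nat \<Rightarrow> 'a" and I
    using that by (induction I rule: infinite_finite_induct) (use assms(1,2) in auto)
  show ?thesis
    using assms(3-5) unfolding Mat_def mat_mult_def by (auto intro!: sum.neutral intro: sum)
qed

lemma mat_one_Mat: "mat_one n \<in> Mat n UNIV"
  by (auto simp: Mat_def mat_one_def)

lemma mat_one_GL: "mat_one n \<in> GL n UNIV"
  using mat_one_Mat mat_mult_one_left unfolding GL_def by blast

lemma GL_inverse:
  assumes "M \<in> GL n S"
  obtains N where "N \<in> GL n S" "mat_mult n M N = mat_one n" "mat_mult n N M = mat_one n"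
  using assms unfolding GL_def by blast

lemma GL_Mat: "M \<in> GL n S \<Longrightarrow> M \<in> Mat n S"
  by (simp add: GL_def)

lemma GL_I:
  "\<lbrakk>M \<in> Mat n S; N \<in> Mat n S; mat_mult n M N = mat_one n; mat_mult n N M = mat_one n\<rbrakk> \<Longrightarrow> M \<in> GL n S"
  unfolding GL_def by blast

lemma mat_cancel_left:
  assumes "mat_mult n L M = mat_one n" "N \<in> Mat n S"
  shows "mat_mult n L (mat_mult n M N) = N"
  using assms by (simp add: mat_mult_one_left flip: mat_mult_assoc)

lemma mat_cancel_right:
  assumes "mat_mult n L M = mat_one n" "N \<in> Mat n S"
  shows "mat_mult n (mat_mult n N L) M = N"
  using assms by (simp add: mat_mult_one_right mat_mult_assoc)

lemma GL_mult:
  assumes "0 \<in> S" "\<And>x y. x \<in> S \<Longrightarrow> y \<in> S \<Longrightarrow> x + y \<in> S" "\<And>x y. x \<in> S \<Longrightarrow> y \<in> S \<Longrightarrow> x * y \<in> S"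
    and M: "M \<in> GL n S" and N: "N \<in> GL n S"
  shows "mat_mult n M N \<in> GL n S"
proof -
  obtain M' N' where M': "M' \<in> GL n S" "mat_mult n M M' = mat_one n" "mat_mult n M' M = mat_one n"
    and N': "N' \<in> GL n S" "mat_mult n N N' = mat_one n" "mat_mult n N' N = mat_one n"
    using M N GL_inverse by metis
  show ?thesis
  proof (rule GL_I)
    show "mat_mult n M N \<in> Mat n S" "mat_mult n N' M' \<in> Mat n S"
      by (intro mat_mult_Mat assms GL_Mat M N M' N'; assumption)+
    show "mat_mult n (mat_mult n M N) (mat_mult n N' M') = mat_one n"
      using mat_cancel_left[OF N'(2) GL_Mat[OF M'(1)]] by (simp add: mat_mult_assoc M')
    show "mat_mult n (mat_mult n N' M') (mat_mult n M N) = mat_one n"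
      using mat_cancel_left[OF M'(3) GL_Mat[OF N]] by (simp add: mat_mult_assoc N')
  qed
qed

lemmas GL_mult_UNIV = GL_mult[of UNIV, simplified]
  and mat_mult_Mat_UNIV = mat_mult_Mat[of UNIV, simplified]

lemma mat_inverse_unique:
  assumes "mat_mult n L M = mat_one n" "mat_mult n M N = mat_one n" "L \<in> Mat n S" "N \<in> Mat n S"
  shows "L = N"
  by (metis assms mat_mult_assoc mat_mult_one_left mat_mult_one_right)

definition map_mat :: "('a \<Rightarrow> 'b) \<Rightarrow> (nat \<Rightarrow> nat \<Rightarrow> 'a) \<Rightarrow> nat \<Rightarrow> nat \<Rightarrow> 'b" where
  "map_mat f M = (\<lambda>i j. f (M i j))"

lemma
  assumes "unital_star_hom f"
  shows map_mat_mult: "map_mat f (mat_mult n M N) = mat_mult n (map_mat f M) (map_mat f N)"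
    and map_mat_one: "map_mat f (mat_one n) = mat_one n"
    and map_mat_Mat: "M \<in> Mat n UNIV \<Longrightarrow> map_mat f M \<in> Mat n UNIV"
    and map_mat_vec: "mat_vec n (map_mat f M) (\<lambda>i. f (a i)) = (\<lambda>i. f (mat_vec n M a i))"
  using assms
  by (auto simp: map_mat_def mat_mult_def mat_one_def Mat_def mat_vec_def fun_eq_iff
      hom_sum hom_mult hom_one hom_zero)

lemma map_mat_GL:
  assumes "unital_star_hom f" "M \<in> GL n UNIV"
  shows "map_mat f M \<in> GL n UNIV"
proof -
  obtain N where "N \<in> GL n UNIV" "mat_mult n M N = mat_one n" "mat_mult n N M = mat_one n"
    using GL_inverse assms(2) .
  with assms show ?thesis
    by (metis GL_I GL_Mat map_mat_mult map_mat_one map_mat_Mat)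
qed

section \<open>Block matrices with one distinguished row and column\<close>

definition block ::
    "nat \<Rightarrow> (nat \<Rightarrow> nat \<Rightarrow> 'a) \<Rightarrow> (nat \<Rightarrow> 'a) \<Rightarrow> (nat \<Rightarrow> 'a) \<Rightarrow> 'a \<Rightarrow> nat \<Rightarrow> nat \<Rightarrow> 'a::zero" where
  "block n P c r d = (\<lambda>i j. if i < n \<and> j < n then P i j else if i < n \<and> j = n then c i
     else if i = n \<and> j < n then r j else if i = n \<and> j = n then d else 0)"

lemma block_Mat: "block n P c r d \<in> Mat (Suc n) UNIV"
  by (auto simp: Mat_def block_def)

text \<open>\<open>block\<close> reads its corner, column and row only at indices below
  \<open>n\<close>, so \<open>M\<close> itself and its full row \<open>M n\<close> can serve as
  arguments.\<close>

lemma block_eta: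
  "M \<in> Mat (Suc n) S \<Longrightarrow> M = block n M (\<lambda>i. M i n) (M n) (M n n)"
  by (auto simp: Mat_def block_def fun_eq_iff not_less less_Suc_eq_le Suc_le_eq nat_less_le)

lemma block_mult:
  "mat_mult (Suc n) (block n P c r d) (block n P' c' r' d') =
    block n (\<lambda>i j. (\<Sum>k<n. P i k * P' k j) + c i * r' j) (\<lambda>i. (\<Sum>k<n. P i k * c' k) + c i * d')
      (\<lambda>j. (\<Sum>k<n. r k * P' k j) + d * r' j) ((\<Sum>k<n. r k * c' k) + d * d')"
  by (auto simp: mat_mult_def block_def fun_eq_iff)

lemma block_cong:
  assumes "\<And>i j. i < n \<Longrightarrow> j < n \<Longrightarrow> P i j = P' i j" "\<And>i. i < n \<Longrightarrow> c i = c' i"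
    "\<And>j. j < n \<Longrightarrow> r j = r' j" "d = d'"
  shows "block n P c r d = block n P' c' r' d'"
  using assms by (auto simp: block_def fun_eq_iff)

lemma block_one: "mat_one (Suc n) = block n (mat_one n) (\<lambda>_. 0) (\<lambda>_. 0) 1"
  by (auto simp: mat_one_def block_def fun_eq_iff)

lemma block_map: "f 0 = 0 \<Longrightarrow>
    map_mat f (block n P c r d) = block n (map_mat f P) (\<lambda>i. f (c i)) (\<lambda>j. f (r j)) (f d)"
  by (auto simp: map_mat_def block_def fun_eq_iff)

lemma block_lower_GL:
  assumes "P \<in> GL n UNIV" "u * v = 1" "v * u = 1"
  shows "block n P (\<lambda>_. 0) r u \<in> GL (Suc n) UNIV"
proof -
  obtain Q where Q: "mat_mult n P Q = mat_one n" "mat_mult n Q P = mat_one n"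
    using GL_inverse assms(1) by blast
  have PQ: "(\<Sum>k<n. P i k * Q k j) = mat_one n i j" "(\<Sum>k<n. Q i k * P k j) = mat_one n i j" for i j
    using Q unfolding mat_mult_def fun_eq_iff by blast+
  \<comment> \<open>The last row of the inverse, left of the diagonal: it solves rQ + us = 0. The
    fact \<open>sum\<close> below gives sP + vr = 0, as the other product requires.\<close>
  define s where "s j = - (v * (\<Sum>k<n. r k * Q k j))" for j
  have sum: "(\<Sum>k<n. s k * P k j) = - (v * r j)" if "j < n" for j
  proof -
    have "(\<Sum>k<n. s k * P k j) = - (v * (\<Sum>k<n. (\<Sum>l<n. r l * Q l k) * P k j))"
      by (simp add: s_def sum_negf mult.assoc flip: sum_distrib_left)
    also have "(\<Sum>k<n. (\<Sum>l<n. r l * Q l k) * P k j) = (\<Sum>l<n. r l * (\<Sum>k<n. Q l k * P k j))"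
      unfolding sum_distrib_left sum_distrib_right mult.assoc by (rule sum.swap)
    also have "\<dots> = r j" using that by (simp add: PQ mat_one_eq_if)
    finally show ?thesis .
  qed
  show ?thesis
  proof (rule GL_I[OF block_Mat block_Mat])
    show "mat_mult (Suc n) (block n P (\<lambda>_. 0) r u) (block n Q (\<lambda>_. 0) s v) = mat_one (Suc n)"
      unfolding block_mult block_one
      by (rule block_cong) (simp_all add: PQ assms s_def flip: mult.assoc)
    show "mat_mult (Suc n) (block n Q (\<lambda>_. 0) s v) (block n P (\<lambda>_. 0) r u) = mat_one (Suc n)"
      unfolding block_mult block_one
      by (rule block_cong) (simp_all add: PQ assms sum)
  qed
qed

lemma block_upper_GL: "block n (mat_one n) c (\<lambda>_. 0) 1 \<in> GL (Suc n) UNIV"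
proof (rule GL_I[OF block_Mat block_Mat])
  show "mat_mult (Suc n) (block n (mat_one n) c (\<lambda>_. 0) 1)
      (block n (mat_one n) (\<lambda>i. - c i) (\<lambda>_. 0) 1) = mat_one (Suc n)"
    "mat_mult (Suc n) (block n (mat_one n) (\<lambda>i. - c i) (\<lambda>_. 0) 1)
      (block n (mat_one n) c (\<lambda>_. 0) 1) = mat_one (Suc n)"
    unfolding block_mult block_one by (rule block_cong; simp add: mat_one_eq_if sum_negf)+
qed

section \<open>Lifting matrices near the identity by Gaussian elimination\<close>

definition near_one :: "nat \<Rightarrow> real \<Rightarrow> (nat \<Rightarrow> nat \<Rightarrow> 'a::unital_cstar_algebra) \<Rightarrow> bool" where
  "near_one n e M \<longleftrightarrow> M \<in> Mat n UNIV \<and> (\<forall>i<n. \<forall>j<n. norm (M i j - mat_one n i j) < e)"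

text \<open>Induction on the size with pivot \<open>M n n\<close>: the matrix is an upper unipotent
  factor times the block diagonal of the Schur complement and the pivot times a lower unipotent
  factor. Unipotent factors stay invertible under any entrywise lift, the pivot lifts by
  \<open>lifts_to_unit_near_one\<close>, and the Schur complement by induction.\<close>

lemma near_one_lifts_to_GL:
  fixes f :: "'a::unital_cstar_algebra \<Rightarrow> 'b::unital_cstar_algebra"
  assumes f: "unital_star_hom f" "surj f"
  shows "\<exists>e>0. \<forall>M. near_one n e M \<longrightarrow> M \<in> map_mat f ` GL n UNIV"
proof (induction n)
  case 0
  \<comment> \<open>The only matrix of size 0 is identically 0, and this is
    \<open>mat_one 0\<close>.\<close>
  have "M = map_mat f (mat_one 0)" if "near_one 0 1 M" for M
    using that hom_zero[OF f(1)]
    by (auto simp: near_one_def Mat_def map_mat_def mat_one_def fun_eq_iff)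
  then show ?case using mat_one_GL[of 0] by (metis imageI zero_less_one)
next
  case (Suc n)
  then obtain e0 where e0: "e0 > 0" "\<And>M. near_one n e0 M \<Longrightarrow> M \<in> map_mat f ` GL n UNIV"
    by blast
  \<comment> \<open>1/8 is the radius for lifting the pivot; the Schur complement then differs from
    1 by less than e + e/4, which is at most \<open>e0\<close>.\<close>
  define e where "e = min (1/8) (e0/2)"
  have e: "e > 0" "e \<le> 1/8" "e \<le> e0/2" using e0 by (auto simp: e_def)
  have "M \<in> map_mat f ` GL (Suc n) UNIV" if M: "near_one (Suc n) e M" for M
  proof -
    let ?d = "M n n"
    have ent: "norm (M i j - mat_one (Suc n) i j) < e" if "i \<le> n" "j \<le> n" for i j
      using M that by (auto simp: near_one_def)
    have "norm (?d - 1) < e" using ent[of n n] by (simp add: mat_one_def)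
    then obtain u v where uv: "f u = ?d" "u * v = 1" "v * u = 1"
      using lifts_to_unit_near_one[OF f, of ?d] e(2) by (auto simp: lifts_to_unit_def)
    define d' where "d' = f v"
    have d': "?d * d' = 1" "d' * ?d = 1"
      using uv hom_mult[OF f(1)] hom_one[OF f(1)] by (metis d'_def)+
    have "norm d' \<le> 2"
    proof -
      have "d' = 1 - d' * (?d - 1)" by (simp add: algebra_simps d')
      then have "norm d' \<le> norm (1::'b) + norm (d' * (?d - 1))"
        by (metis norm_triangle_ineq4)
      also have "\<dots> \<le> 1 + norm d' * (1/8)"
        using \<open>norm (?d - 1) < e\<close> e(2)
        by (intro add_mono norm_one_le order_trans[OF norm_mult_ineq] mult_left_mono) auto
      finally show ?thesis by simp
    qed
    \<comment> \<open>The Schur complement of the pivot.\<close>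
    define X where "X = (\<lambda>i j. if i < n \<and> j < n then M i j - M i n * d' * M n j else 0)"
    have "near_one n e0 X"
      unfolding near_one_def
    proof (intro conjI allI impI)
      show "X \<in> Mat n UNIV" by (auto simp: X_def Mat_def)
      fix i j assume ij: "i < n" "j < n"
      have "norm (M i n) \<le> e" "norm (M n j) \<le> 1/8"
        using ent[of i n] ent[of n j] ij e(2) by (auto simp: mat_one_def)
      then have "norm (M i n * d' * M n j) \<le> e * 2 * (1/8)"
        using \<open>norm d' \<le> 2\<close> e(1)
        by (intro order_trans[OF norm_mult_ineq] mult_mono) auto
      have "norm (M i j - mat_one n i j - M i n * d' * M n j)
          \<le> norm (M i j - mat_one n i j) + norm (M i n * d' * M n j)"
        by (rule norm_triangle_ineq4)
      also have "\<dots> < e + e * 2 * (1/8)"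
        using ent[of i j] ij \<open>norm (M i n * d' * M n j) \<le> _\<close>
        by (intro add_less_le_mono) (auto simp: mat_one_def)
      also have "\<dots> \<le> e0" using e by simp
      finally show "norm (X i j - mat_one n i j) < e0"
        using ij by (simp add: X_def algebra_simps)
    qed
    then obtain N where N: "N \<in> GL n UNIV" "map_mat f N = X" using e0(2) by blast
    define c where "c i = inv_into UNIV f (M i n * d')" for i
    define r where "r j = inv_into UNIV f (d' * M n j)" for j
    have cr: "f (c i) = M i n * d'" "f (r j) = d' * M n j" for i j
      using surj_f_inv_f[OF f(2)] by (auto simp: c_def r_def)
    let ?L = "mat_mult (Suc n) (block n (mat_one n) c (\<lambda>_. 0) 1)
      (mat_mult (Suc n) (block n N (\<lambda>_. 0) (\<lambda>_. 0) u) (block n (mat_one n) (\<lambda>_. 0) r 1))"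
    have "?L \<in> GL (Suc n) UNIV"
      using N(1) uv by (intro GL_mult_UNIV block_upper_GL block_lower_GL[where v = v]
          block_lower_GL[where v = 1] mat_one_GL) auto
    moreover have "map_mat f ?L = M"
    proof -
      have "map_mat f ?L = mat_mult (Suc n) (block n (mat_one n) (\<lambda>i. M i n * d') (\<lambda>_. 0) 1)
        (mat_mult (Suc n) (block n X (\<lambda>_. 0) (\<lambda>_. 0) ?d)
          (block n (mat_one n) (\<lambda>_. 0) (\<lambda>j. d' * M n j) 1))"
        using f(1) by (simp add: map_mat_mult block_map hom_zero hom_one map_mat_one cr N uv)
      also have "\<dots> = block n M (\<lambda>i. M i n) (M n) (M n n)"
        unfolding block_mult
      proof (rule block_cong, goal_cases)
        case (1 i j)
        have "M i n * d' * (M n n * (d' * M n j)) = M i n * d' * ((M n n * d') * M n j)"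
          by (simp add: mult.assoc)
        with 1 show ?case by (simp add: mat_one_eq_if X_def d')
      qed (simp_all add: mat_one_eq_if mult.assoc d', simp flip: mult.assoc add: d')
      also have "\<dots> = M" using M block_eta unfolding near_one_def by metis
      finally show ?thesis .
    qed
    ultimately show ?thesis by blast
  qed
  then show ?case using \<open>e > 0\<close> by blast
qed

section \<open>Components of the general linear group\<close>

lemma unital_star_hom_id: "unital_star_hom (\<lambda>x::'a::unital_cstar_algebra. x)"
  by (simp add: unital_star_hom_def)

text \<open>Multiplication by the inverse \<open>M'\<close> moves a matrix near \<open>M\<close> to
  one near 1, and such matrices are images of invertible ones. Applied to the identity homomorphism,
  this says that \<open>GL\<close> is open.\<close>

lemma GL_nearby:
  fixes f :: "'a::unital_cstar_algebra \<Rightarrow> 'b::unital_cstar_algebra"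
  assumes f: "unital_star_hom f" "surj f" and M: "M \<in> GL n UNIV"
  shows "\<exists>e>0. \<forall>N\<in>Mat n UNIV. (\<forall>i<n. \<forall>j<n. norm (N i j - M i j) < e) \<longrightarrow>
    (\<exists>L\<in>GL n UNIV. N = mat_mult n M (map_mat f L))"
proof -
  obtain M' where M': "M' \<in> GL n UNIV" "mat_mult n M M' = mat_one n" "mat_mult n M' M = mat_one n"
    using GL_inverse M .
  obtain e0 where e0: "e0 > 0" "\<And>X. near_one n e0 X \<Longrightarrow> X \<in> map_mat f ` GL n UNIV"
    using near_one_lifts_to_GL[OF f] by blast
  \<comment> \<open>\<open>K\<close> bounds every row sum of norms in \<open>M'\<close>; the
    denominator \<open>K + 1\<close> is positive even if \<open>K\<close> vanishes.\<close>
  define K where "K = (\<Sum>i<n. \<Sum>k<n. norm (M' i k))"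
  have K: "K \<ge> 0" unfolding K_def by (intro sum_nonneg norm_ge_zero)
  define e where "e = e0 / (K + 1)"
  have e: "e > 0" "K * e < e0"
    using K e0(1) by (simp_all add: e_def field_simps)
  have "\<exists>L\<in>GL n UNIV. N = mat_mult n M (map_mat f L)"
    if N: "N \<in> Mat n UNIV" "\<And>i j. i < n \<Longrightarrow> j < n \<Longrightarrow> norm (N i j - M i j) < e" for N
  proof -
    have "near_one n e0 (mat_mult n M' N)"
      unfolding near_one_def
    proof (intro conjI allI impI)
      show "mat_mult n M' N \<in> Mat n UNIV" by (intro mat_mult_Mat_UNIV GL_Mat M' N(1))
      fix i j assume ij: "i < n" "j < n"
      have "mat_mult n M' N i j - mat_one n i j = (\<Sum>k<n. M' i k * (N k j - M k j))"
        by (simp add: mat_mult_def sum_subtractf right_diff_distrib flip: M'(3))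
      also have "norm \<dots> \<le> (\<Sum>k<n. norm (M' i k) * e)"
      proof (rule sum_norm_le)
        fix k assume "k \<in> {..<n}"
        then have "norm (N k j - M k j) \<le> e" using N(2)[of k j] ij by simp
        then show "norm (M' i k * (N k j - M k j)) \<le> norm (M' i k) * e"
          by (intro order_trans[OF norm_mult_ineq] mult_left_mono) auto
      qed
      also have "\<dots> = (\<Sum>k<n. norm (M' i k)) * e" by (simp add: sum_distrib_right)
      also have "\<dots> \<le> K * e"
        unfolding K_def using ij e(1)
        by (intro mult_right_mono member_le_sum[where f = "\<lambda>i. \<Sum>k<n. norm (M' i k)"] sum_nonneg) auto
      finally show "norm (mat_mult n M' N i j - mat_one n i j) < e0" using e(2) by simp
    qed
    then obtain L where L: "L \<in> GL n UNIV" "mat_mult n M' N = map_mat f L" using e0(2) by blast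
    then show ?thesis using mat_cancel_left[OF M'(2) N(1)] by metis
  qed
  then show ?thesis using e(1) by blast
qed

lemma path_component_segment:
  fixes M N :: "nat \<Rightarrow> nat \<Rightarrow> 'a::real_normed_vector"
  assumes "\<And>t. 0 \<le> t \<Longrightarrow> t \<le> 1 \<Longrightarrow> (\<lambda>i j. (1 - t) *\<^sub>R M i j + t *\<^sub>R N i j) \<in> S"
  shows "path_component S M N"
proof -
  let ?g = "\<lambda>t::real. \<lambda>i j. (1 - t) *\<^sub>R M i j + t *\<^sub>R N i j"
  have "path ?g"
    unfolding path_def by (intro continuous_on_coordinatewise_then_product continuous_intros)
  moreover have "path_image ?g \<subseteq> S" using assms by (auto simp: path_image_def)
  moreover have "pathstart ?g = M" "pathfinish ?g = N" by (simp_all add: pathstart_def pathfinish_def)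
  ultimately show ?thesis unfolding path_component_def by blast
qed

text \<open>Each point of the segment is entrywise at least as close to \<open>M\<close> as
  \<open>N\<close> is, so \<open>GL_nearby\<close> for the identity homomorphism covers the whole
  segment.\<close>

lemma GL_nearby_segment:
  fixes M :: "nat \<Rightarrow> nat \<Rightarrow> 'a::unital_cstar_algebra"
  assumes M: "M \<in> GL n UNIV"
  shows "\<exists>e>0. \<forall>N\<in>Mat n UNIV. (\<forall>i<n. \<forall>j<n. norm (N i j - M i j) < e) \<longrightarrow>
    (\<forall>t. 0 \<le> t \<and> t \<le> 1 \<longrightarrow> (\<lambda>i j. (1 - t) *\<^sub>R M i j + t *\<^sub>R N i j) \<in> GL n UNIV)"
proof -
  obtain e where e: "e > 0" and near: "\<And>N. N \<in> Mat n UNIV \<Longrightarrow>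
      \<forall>i<n. \<forall>j<n. norm (N i j - M i j) < e \<Longrightarrow> \<exists>L\<in>GL n UNIV. N = mat_mult n M L"
    using GL_nearby[OF unital_star_hom_id _ M] by (auto simp: map_mat_def)
  have "(\<lambda>i j. (1 - t) *\<^sub>R M i j + t *\<^sub>R N i j) \<in> GL n UNIV"
    if N: "N \<in> Mat n UNIV" "\<And>i j. i < n \<Longrightarrow> j < n \<Longrightarrow> norm (N i j - M i j) < e"
      and t: "0 \<le> t" "t \<le> 1" for N t
  proof -
    let ?X = "\<lambda>i j. (1 - t) *\<^sub>R M i j + t *\<^sub>R N i j"
    have "norm (?X i j - M i j) < e" if "i < n" "j < n" for i j
    proof -
      have "?X i j - M i j = t *\<^sub>R (N i j - M i j)" by (simp add: algebra_simps)
      then have "norm (?X i j - M i j) = t * norm (N i j - M i j)" using t by simp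
      also have "\<dots> \<le> 1 * norm (N i j - M i j)" by (intro mult_right_mono t) auto
      finally show ?thesis using N(2)[OF that] by simp
    qed
    moreover have "?X \<in> Mat n UNIV" using N(1) GL_Mat[OF M] by (auto simp: Mat_def)
    ultimately obtain L where "L \<in> GL n UNIV" "?X = mat_mult n M L" using near by blast
    then show ?thesis using GL_mult_UNIV M by metis
  qed
  then show ?thesis using e by blast
qed

section \<open>Propagating local relations along connected sets\<close>

lemma continuous_on_matrix_entry:
  "continuous_on S (\<lambda>N :: nat \<Rightarrow> nat \<Rightarrow> 'a::topological_space. N i j)"
proof -
  have "continuous_on S (\<lambda>N :: nat \<Rightarrow> nat \<Rightarrow> 'a. N i)"
    by (rule continuous_on_subset[OF continuous_on_product_coordinates subset_UNIV])
  from continuous_on_product_then_coordinatewise[OF this, of j] show ?thesis .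
qed

lemma open_entrywise_ball:
  fixes M :: "nat \<Rightarrow> nat \<Rightarrow> 'a::real_normed_vector"
  shows "open {N. \<forall>i<n. \<forall>j<n. norm (N i j - M i j) < e}"
proof -
  have "open {N. norm (N i j - M i j) < e}" for i j
    by (intro open_Collect_less continuous_intros continuous_on_matrix_entry)
  then have "open (\<Inter>i<n. \<Inter>j<n. {N. norm (N i j - M i j) < e})" by (intro open_INT) auto
  also have "(\<Inter>i<n. \<Inter>j<n. {N. norm (N i j - M i j) < e}) =
      {N. \<forall>i<n. \<forall>j<n. norm (N i j - M i j) < e}" by auto
  finally show ?thesis .
qed

text \<open>Nearby points are related, so the classes of \<open>R\<close> in \<open>T\<close> are
  open and connectedness leaves only one. This serves relations defined through a homomorphism whose
  continuity is not established: joining images by a path, and right translation by images.\<close>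

lemma connected_GL_relation:
  fixes R :: "(nat \<Rightarrow> nat \<Rightarrow> 'a::unital_cstar_algebra) \<Rightarrow> (nat \<Rightarrow> nat \<Rightarrow> 'a) \<Rightarrow> bool"
  assumes "connected T" "T \<subseteq> GL n UNIV" "a \<in> T" "b \<in> T"
    and sym: "\<And>x y. R x y \<Longrightarrow> R y x"
    and trans: "\<And>x y z. R x y \<Longrightarrow> R y z \<Longrightarrow> R x z"
    and near: "\<And>x. x \<in> GL n UNIV \<Longrightarrow>
      \<exists>e>0. \<forall>y\<in>Mat n UNIV. (\<forall>i<n. \<forall>j<n. norm (y i j - x i j) < e) \<longrightarrow> R x y"
  shows "R a b"
proof (rule connected_equivalence_relation[OF assms(1,3,4)])
  fix x assume x: "x \<in> T"
  then have "x \<in> GL n UNIV" using \<open>T \<subseteq> GL n UNIV\<close> by blast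
  from near[OF this] obtain e where e: "e > 0"
    "\<forall>y\<in>Mat n UNIV. (\<forall>i<n. \<forall>j<n. norm (y i j - x i j) < e) \<longrightarrow> R x y"
    by blast
  let ?U = "{y. \<forall>i<n. \<forall>j<n. norm (y i j - x i j) < e}"
  have "openin (top_of_set T) (T \<inter> ?U)" using open_entrywise_ball by (rule openin_open_Int)
  moreover have "x \<in> T \<inter> ?U" using x e(1) by simp
  moreover have "R x y" if "y \<in> T \<inter> ?U" for y
  proof -
    have "y \<in> Mat n UNIV" using that \<open>T \<subseteq> GL n UNIV\<close> by (blast intro: GL_Mat)
    with e(2) that show ?thesis by simp
  qed
  ultimately show "\<exists>U. openin (top_of_set T) U \<and> x \<in> U \<and> (\<forall>y\<in>U. R x y)" by blast
qed (use sym trans in blast)+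

text \<open>Short segments in \<open>GL\<^sub>n\<close> are mapped to segments, which are paths whether or not \<open>f\<close> is
  continuous.\<close>

lemma GL0_path_component:
  assumes f: "unital_star_hom f" and M: "M \<in> GL0 n UNIV"
  shows "path_component (GL n UNIV) (mat_one n) (map_mat f M)"
proof -
  from M obtain T where T: "connected T" "T \<subseteq> GL n UNIV" "mat_one n \<in> T" "M \<in> T"
    by (auto simp: GL0_def connected_component_def)
  have "path_component (GL n UNIV) (map_mat f (mat_one n)) (map_mat f M)"
  proof (rule connected_GL_relation[OF T])
    fix x :: "nat \<Rightarrow> nat \<Rightarrow> 'a" assume "x \<in> GL n UNIV"
    then obtain e where e: "e > 0" and seg: "\<And>y t. y \<in> Mat n UNIV \<Longrightarrow>
        \<forall>i<n. \<forall>j<n. norm (y i j - x i j) < e \<Longrightarrow> 0 \<le> t \<Longrightarrow> t \<le> 1 \<Longrightarrow>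
        (\<lambda>i j. (1 - t) *\<^sub>R x i j + t *\<^sub>R y i j) \<in> GL n UNIV"
      using GL_nearby_segment by blast
    have "path_component (GL n UNIV) (map_mat f x) (map_mat f y)"
      if "y \<in> Mat n UNIV" "\<forall>i<n. \<forall>j<n. norm (y i j - x i j) < e" for y
    proof (rule path_component_segment)
      fix t :: real assume "0 \<le> t" "t \<le> 1"
      from map_mat_GL[OF f seg[OF that this]]
      show "(\<lambda>i j. (1 - t) *\<^sub>R map_mat f x i j + t *\<^sub>R map_mat f y i j) \<in> GL n UNIV"
        by (simp add: map_mat_def hom_add[OF f] hom_scaleR[OF f])
    qed
    then show "\<exists>e>0. \<forall>y\<in>Mat n UNIV. (\<forall>i<n. \<forall>j<n. norm (y i j - x i j) < e) \<longrightarrow>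
        path_component (GL n UNIV) (map_mat f x) (map_mat f y)" using e by blast
  qed (blast intro: path_component_sym path_component_trans)+
  then show ?thesis by (simp add: map_mat_one[OF f])
qed

text \<open>By \<open>GL_nearby\<close>, nearby matrices differ by a right factor that is the image
  of an invertible matrix. Chaining such steps from 1 to \<open>g\<close> makes \<open>g\<close>
  itself such an image.\<close>

lemma path_component_lifts_to_GL:
  fixes f :: "'a::unital_cstar_algebra \<Rightarrow> 'b::unital_cstar_algebra"
  assumes f: "unital_star_hom f" "surj f" and g: "path_component (GL n UNIV) (mat_one n) g"
  obtains L where "L \<in> GL n UNIV" "map_mat f L = g"
proof -
  have "connected_component (GL n UNIV) (mat_one n) g"
    using subsetD[OF path_component_subset_connected_component, of g] g by simp
  then obtain T where T: "connected T" "T \<subseteq> GL n UNIV" "mat_one n \<in> T" "g \<in> T"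
    by (auto simp: connected_component_def)
  \<comment> \<open>Membership in \<open>GL\<close> is carried along so that the right factor can be
    cancelled when the relation is reversed.\<close>
  let ?R = "\<lambda>x y :: nat \<Rightarrow> nat \<Rightarrow> 'b. x \<in> GL n UNIV \<and> y \<in> GL n UNIV \<and>
    (\<exists>L\<in>GL n UNIV. y = mat_mult n x (map_mat f L))"
  have "?R (mat_one n) g"
  proof (rule connected_GL_relation[OF T])
    fix x y assume R: "?R x y"
    then obtain L where L: "L \<in> GL n UNIV" "y = mat_mult n x (map_mat f L)" by blast
    then obtain L' where L': "L' \<in> GL n UNIV" "mat_mult n L L' = mat_one n" using GL_inverse by blast
    then have "mat_mult n (map_mat f L) (map_mat f L') = mat_one n"
      using map_mat_mult[OF f(1)] map_mat_one[OF f(1)] by metis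
    then have "x = mat_mult n y (map_mat f L')"
      unfolding L(2) using mat_cancel_right GL_Mat R by metis
    with R L' show "?R y x" by blast
  next
    fix x y z assume R: "?R x y" "?R y z"
    then obtain L L' where "L \<in> GL n UNIV" "y = mat_mult n x (map_mat f L)"
      "L' \<in> GL n UNIV" "z = mat_mult n y (map_mat f L')" by blast
    then have "mat_mult n L L' \<in> GL n UNIV" "z = mat_mult n x (map_mat f (mat_mult n L L'))"
      by (simp_all add: GL_mult_UNIV map_mat_mult[OF f(1)] mat_mult_assoc)
    with R show "?R x z" by blast
  next
    fix x :: "nat \<Rightarrow> nat \<Rightarrow> 'b" assume x: "x \<in> GL n UNIV"
    have "mat_mult n x (map_mat f L) \<in> GL n UNIV" if "L \<in> GL n UNIV" for L
      using that x GL_mult_UNIV map_mat_GL[OF f(1)] by blast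
    then show "\<exists>e>0. \<forall>y\<in>Mat n UNIV. (\<forall>i<n. \<forall>j<n. norm (y i j - x i j) < e) \<longrightarrow> ?R x y"
      using GL_nearby[OF f x] x by metis
  qed
  then obtain L where "L \<in> GL n UNIV" "g = mat_mult n (mat_one n) (map_mat f L)" by blast
  then show thesis
    using that mat_mult_one_left[OF GL_Mat[OF map_mat_GL[OF f(1)]]] by metis
qed

section \<open>Paths of invertible matrices under products\<close>

lemma path_component_continuous_image:
  assumes "path_component S x y" "continuous_on S h" "h ` S \<subseteq> T"
  shows "path_component T (h x) (h y)"
proof -
  obtain g where g: "path g" "path_image g \<subseteq> S" "pathstart g = x" "pathfinish g = y"
    using assms(1) by (auto simp: path_component_def)
  have "path (h \<circ> g)" using g assms(2) by (blast intro: path_continuous_image continuous_on_subset)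
  then show ?thesis
    unfolding path_component_def using g assms(3)
    by (intro exI[of _ "h \<circ> g"]) (auto simp: path_image_compose pathstart_compose pathfinish_compose)
qed

lemma path_component_mult_right:
  fixes M :: "nat \<Rightarrow> nat \<Rightarrow> 'a::unital_cstar_algebra"
  assumes "path_component (GL n UNIV) M N" "L \<in> GL n UNIV"
  shows "path_component (GL n UNIV) (mat_mult n M L) (mat_mult n N L)"
  using assms(1)
proof (rule path_component_continuous_image)
  show "continuous_on (GL n UNIV) (\<lambda>M. mat_mult n M L)"
    unfolding mat_mult_def
    by (intro continuous_on_coordinatewise_then_product continuous_intros continuous_on_matrix_entry)
qed (use GL_mult_UNIV assms(2) in blast)

lemma path_component_mult_left:
  fixes M :: "nat \<Rightarrow> nat \<Rightarrow> 'a::unital_cstar_algebra"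
  assumes "path_component (GL n UNIV) M N" "L \<in> GL n UNIV"
  shows "path_component (GL n UNIV) (mat_mult n L M) (mat_mult n L N)"
  using assms(1)
proof (rule path_component_continuous_image)
  show "continuous_on (GL n UNIV) (\<lambda>M. mat_mult n L M)"
    unfolding mat_mult_def
    by (intro continuous_on_coordinatewise_then_product continuous_intros continuous_on_matrix_entry)
qed (use GL_mult_UNIV assms(2) in blast)

section \<open>Stabilization by identity blocks and vanishing of K1\<close>

lemma mat_pad_eq_block: "g \<in> Mat n S \<Longrightarrow> mat_pad n (Suc n) g = block n g (\<lambda>_. 0) (\<lambda>_. 0) 1"
  by (auto simp: mat_pad_def block_def Mat_def fun_eq_iff)

lemma mat_pad_one: "n \<le> k \<Longrightarrow> mat_pad n k (mat_one n) = mat_one k"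
  by (auto simp: mat_pad_def mat_one_def fun_eq_iff)

lemma mat_pad_self: "mat_pad n n g = g"
  by (auto simp: mat_pad_def fun_eq_iff)

lemma mat_pad_Suc: "n \<le> k \<Longrightarrow> mat_pad n (Suc k) g = mat_pad k (Suc k) (mat_pad n k g)"
  by (auto simp: mat_pad_def fun_eq_iff)

lemma mat_pad_Suc_GL: "g \<in> GL n UNIV \<Longrightarrow> mat_pad n (Suc n) g \<in> GL (Suc n) UNIV"
  using block_lower_GL[of g n 1 1] by (simp add: mat_pad_eq_block[OF GL_Mat])

lemma mat_pad_GL: "n \<le> k \<Longrightarrow> g \<in> GL n UNIV \<Longrightarrow> mat_pad n k g \<in> GL k UNIV"
proof (induction k rule: dec_induct)
  case (step k)
  then show ?case unfolding mat_pad_Suc[OF step.hyps(1)] by (intro mat_pad_Suc_GL step.IH step.prems)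
qed (simp add: mat_pad_self)

lemma path_component_mat_pad:
  fixes g :: "nat \<Rightarrow> nat \<Rightarrow> 'a::unital_cstar_algebra"
  assumes "path_component (GL n UNIV) g h"
  shows "path_component (GL (Suc n) UNIV) (mat_pad n (Suc n) g) (mat_pad n (Suc n) h)"
  using assms
proof (rule path_component_continuous_image)
  have "continuous_on (GL n UNIV) (\<lambda>g. if P then (1::'a) else g i j)" for P i j
    by (cases P) (simp_all add: continuous_on_matrix_entry)
  then show "continuous_on (GL n UNIV) (mat_pad n (Suc n) :: (nat \<Rightarrow> nat \<Rightarrow> 'a) \<Rightarrow> _)"
    unfolding mat_pad_def by (intro continuous_on_coordinatewise_then_product)
qed (use mat_pad_Suc_GL in blast)

text \<open>Injectivity is applied to the components of \<open>g\<close> and of 1, which have the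
  same image because their paddings are joined by a path.\<close>

lemma inj_pi0_mat_pad_descends:
  fixes g :: "nat \<Rightarrow> nat \<Rightarrow> 'a::unital_cstar_algebra"
  assumes inj: "inj_on (pi0_map (GL (Suc n) UNIV) (mat_pad n (Suc n))) (pi0 (GL n (UNIV :: 'a set)))"
    and g: "g \<in> GL n UNIV"
    and path: "path_component (GL (Suc n) UNIV) (mat_one (Suc n)) (mat_pad n (Suc n) g)"
  shows "path_component (GL n UNIV) (mat_one n) g"
proof -
  let ?G = "GL n (UNIV :: 'a set)" and ?G' = "GL (Suc n) (UNIV :: 'a set)"
  have pi0: "path_component_set ?G x \<in> pi0 ?G" if "x \<in> ?G" for x
    using that by (auto simp: pi0_def path_components_of_def)
  \<comment> \<open>Padding is continuous, so all sets in the union defining \<open>pi0_map\<close>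
    are the component of the padded \<open>x\<close>.\<close>
  have image: "pi0_map ?G' (mat_pad n (Suc n)) (path_component_set ?G x) =
      path_component_set ?G' (mat_pad n (Suc n) x)" if "x \<in> ?G" for x
  proof -
    have "path_component_set ?G' (mat_pad n (Suc n) u) = path_component_set ?G' (mat_pad n (Suc n) x)"
      if "u \<in> path_component_set ?G x" for u
      using that path_component_mat_pad by (intro path_component_eq) auto
    moreover have "x \<in> path_component_set ?G x" using that by (simp add: path_component_refl)
    ultimately show ?thesis unfolding pi0_map_def by blast
  qed
  have "path_component_set ?G' (mat_pad n (Suc n) g) =
      path_component_set ?G' (mat_pad n (Suc n) (mat_one n))"
    using path by (intro path_component_eq) (simp add: mat_pad_one)
  then have "path_component_set ?G g = path_component_set ?G (mat_one n)"
    by (intro inj_onD[OF inj _ pi0[OF g] pi0[OF mat_one_GL]])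
      (simp only: image[OF g] image[OF mat_one_GL])
  then show ?thesis using path_component_refl[OF g] by blast
qed

text \<open>An element of a trivial direct limit dies at a finite stage: \<open>(n, g)\<close> is
  identified with the empty matrix \<open>(0, mat_one 0)\<close>, whose padding to any size is the
  identity.\<close>

lemma K1_trivial_path_component:
  fixes g :: "nat \<Rightarrow> nat \<Rightarrow> 'a::unital_cstar_algebra"
  assumes K1: "carrier (K1 (UNIV :: 'a set)) = {\<one>\<^bsub>K1 (UNIV :: 'a set)\<^esub>}" and g: "g \<in> GL n UNIV"
  obtains k where "k \<ge> n" "path_component (GL k UNIV) (mat_one k) (mat_pad n k g)"
proof -
  let ?R = "K1_rel (UNIV :: 'a set)"
  have "?R `` {(n, g)} \<in> carrier (K1 (UNIV :: 'a set))"
    using g by (auto simp: K1_def intro!: quotientI)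
  then have eq: "?R `` {(n, g)} = ?R `` {(0, mat_one 0)}"
    unfolding K1 by (simp add: K1_def)
  \<comment> \<open>Reflexivity at \<open>(n, g)\<close> turns the equality of classes into the
    relation itself.\<close>
  have "(n, g) \<in> ?R `` {(n, g)}"
    using g path_component_refl[OF g] by (auto simp: K1_rel_def mat_pad_self)
  then have "((0, mat_one 0), (n, g)) \<in> ?R" unfolding eq by simp
  then show thesis using that by (auto simp: K1_rel_def mat_pad_one)
qed

text \<open>Stabilization is undone one size at a time from \<open>k\<close> down to
  \<open>n\<close>, so injectivity is assumed at every size from \<open>n\<close> on.\<close>

lemma inj_pi0_mat_pad_descends_iterated:
  fixes g :: "nat \<Rightarrow> nat \<Rightarrow> 'a::unital_cstar_algebra"
  assumes inj: "\<And>k. k \<ge> n \<Longrightarrow>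
      inj_on (pi0_map (GL (Suc k) UNIV) (mat_pad k (Suc k))) (pi0 (GL k (UNIV :: 'a set)))"
    and g: "g \<in> GL n UNIV" and "n \<le> k"
    and path: "path_component (GL k UNIV) (mat_one k) (mat_pad n k g)"
  shows "path_component (GL n UNIV) (mat_one n) g"
  using \<open>n \<le> k\<close> path
proof (induction k rule: nat_induct_at_least)
  case base
  then show ?case by (simp add: mat_pad_self)
next
  case (Suc k)
  have "path_component (GL k UNIV) (mat_one k) (mat_pad n k g)"
    by (rule inj_pi0_mat_pad_descends[OF inj[OF Suc.hyps] mat_pad_GL[OF Suc.hyps g]])
      (use Suc.prems in \<open>simp only: mat_pad_Suc[OF Suc.hyps, symmetric]\<close>)
  then show ?case by (rule Suc.IH)
qed

section \<open>Gluing over the pullback\<close>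

abbreviation last_unit :: "nat \<Rightarrow> nat \<Rightarrow> 'a::{zero, one}" where
  "last_unit n \<equiv> (\<lambda>i. if i = n then 1 else 0)"

lemma mat_vec_last_unit: "mat_vec (Suc n) M (last_unit n) = (\<lambda>i. M i n)"
  for M :: "nat \<Rightarrow> nat \<Rightarrow> 'a::{ring, monoid_mult}"
proof -
  have "M i j * last_unit n j = (if j = n then M i n else 0)" for i j by simp
  then show ?thesis unfolding mat_vec_def by (simp del: sum.lessThan_Suc)
qed

lemma Lg_UNIV_I:
  fixes a :: "nat \<Rightarrow> 'a::{ring, monoid_mult}"
  assumes "a \<in> Vec n UNIV" "(\<Sum>i<n. x i * a i) = 1"
  shows "a \<in> Lg n UNIV"
proof -
  have "\<exists>z. y = (\<Sum>i<n. z i * a i) \<and> z \<in> Vec n UNIV" for y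
  proof (intro exI conjI)
    \<comment> \<open>The coefficients are cut off at \<open>n\<close> because \<open>x\<close> is
      arbitrary beyond it, while \<open>Vec\<close> demands zeros there.\<close>
    let ?z = "\<lambda>i. if i < n then y * x i else 0"
    have "(\<Sum>i<n. ?z i * a i) = y * (\<Sum>i<n. x i * a i)"
      by (simp add: sum_distrib_left mult.assoc)
    with assms(2) show "y = (\<Sum>i<n. ?z i * a i)" by simp
    show "?z \<in> Vec n UNIV" by (simp add: Vec_def)
  qed
  with assms(1) show ?thesis by (auto simp: Lg_def)
qed

lemma last_unit_Lg: "(last_unit n :: nat \<Rightarrow> 'a::{ring, monoid_mult}) \<in> Lg (Suc n) UNIV"
proof (rule Lg_UNIV_I)
  show "(\<Sum>i<Suc n. last_unit n i * last_unit n i) = (1 :: 'a)" by simp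
qed (simp add: Vec_def)

lemma last_unit_Vec: "(last_unit n :: nat \<Rightarrow> 'a::{ring, monoid_mult}) \<in> Vec (Suc n) UNIV"
  by (simp add: Vec_def)

lemma mat_vec_inverse:
  "\<lbrakk>mat_mult n L M = mat_one n; mat_vec n M a = b; a \<in> Vec n S\<rbrakk> \<Longrightarrow> mat_vec n L b = a"
  by (auto simp: mat_vec_one simp flip: mat_vec_mat_mult)

text \<open>Fixing the last unit vector prescribes the last column. The inverse fixes that vector
  too, so both matrices are block lower triangular, and the corners of their two products show that
  \<open>g\<close> is invertible.\<close>

lemma stabilizer_last_unit:
  assumes h: "h \<in> GL (Suc n) UNIV" "mat_vec (Suc n) h (last_unit n) = last_unit n"
  obtains g r where "g \<in> GL n UNIV" "h = block n g (\<lambda>_. 0) r 1"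
proof -
  have form: "L = block n (\<lambda>i j. if i < n \<and> j < n then L i j else 0) (\<lambda>_. 0) (L n) 1"
    if "L \<in> GL (Suc n) UNIV" "mat_vec (Suc n) L (last_unit n) = last_unit n" for L :: "nat \<Rightarrow> nat \<Rightarrow> 'a"
  proof -
    have "L i n = last_unit n i" for i
      using that(2) unfolding mat_vec_last_unit by metis
    then have "block n (\<lambda>i j. if i < n \<and> j < n then L i j else 0) (\<lambda>_. 0) (L n) 1
        = block n L (\<lambda>i. L i n) (L n) (L n n)"
      by (intro block_cong) auto
    then show ?thesis using block_eta[OF GL_Mat[OF that(1)]] by simp
  qed
  obtain h' where h': "h' \<in> GL (Suc n) UNIV" "mat_mult (Suc n) h h' = mat_one (Suc n)"
      "mat_mult (Suc n) h' h = mat_one (Suc n)"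
    using GL_inverse h(1) .
  have h'e: "mat_vec (Suc n) h' (last_unit n) = last_unit n"
    by (rule mat_vec_inverse[OF h'(3) h(2) last_unit_Vec])
  define g where "g = (\<lambda>i j. if i < n \<and> j < n then h i j else 0)"
  define g' where "g' = (\<lambda>i j. if i < n \<and> j < n then h' i j else 0)"
  have hb: "h = block n g (\<lambda>_. 0) (h n) 1" and hb': "h' = block n g' (\<lambda>_. 0) (h' n) 1"
    unfolding g_def g'_def using form[OF h] form[OF h'(1) h'e] .
  have "g \<in> GL n UNIV"
  proof (rule GL_I)
    have prods: "mat_mult (Suc n) (block n g (\<lambda>_. 0) (h n) 1) (block n g' (\<lambda>_. 0) (h' n) 1) = mat_one (Suc n)"
      "mat_mult (Suc n) (block n g' (\<lambda>_. 0) (h' n) 1) (block n g (\<lambda>_. 0) (h n) 1) = mat_one (Suc n)"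
      using h'(2,3) unfolding hb[symmetric] hb'[symmetric] .
    show G: "g \<in> Mat n UNIV" "g' \<in> Mat n UNIV" by (auto simp: g_def g'_def Mat_def)
    have corner: "mat_mult n P Q = mat_one n"
      if PQ: "mat_mult (Suc n) (block n P (\<lambda>_. 0) r 1) (block n Q (\<lambda>_. 0) s 1) = mat_one (Suc n)"
        and "P \<in> Mat n UNIV" "Q \<in> Mat n UNIV" for P Q :: "nat \<Rightarrow> nat \<Rightarrow> 'a" and r s
    proof (intro ext)
      fix i j
      have "mat_mult n P Q \<in> Mat n UNIV" using that by (intro mat_mult_Mat_UNIV)
      moreover have "(\<Sum>k<n. P i k * Q k j) = mat_one n i j" if "i < n" "j < n"
        using fun_cong[OF fun_cong[OF PQ, of i], of j] that
        unfolding block_mult block_one by (simp add: block_def)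
      ultimately show "mat_mult n P Q i j = mat_one n i j"
        using Mat_outside[of "mat_mult n P Q"] Mat_outside[OF mat_one_Mat, of n i j]
        by (cases "i < n \<and> j < n") (auto simp: mat_mult_def not_less)
    qed
    show "mat_mult n g g' = mat_one n" "mat_mult n g' g = mat_one n"
      using corner[OF prods(1) G] corner[OF prods(2) G(2,1)] .
  qed
  then show thesis using that hb by blast
qed

text \<open>The last row shrinks linearly to 0; all matrices on the way are block lower triangular
  with the same invertible diagonal blocks.\<close>

lemma path_component_corner:
  fixes g :: "nat \<Rightarrow> nat \<Rightarrow> 'a::unital_cstar_algebra"
  assumes "g \<in> GL n UNIV"
  shows "path_component (GL (Suc n) UNIV) (block n g (\<lambda>_. 0) r 1) (mat_pad n (Suc n) g)"
proof (rule path_component_segment)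
  fix t :: real assume t: "0 \<le> t" "t \<le> 1"
  have "(\<lambda>i j. (1 - t) *\<^sub>R block n g (\<lambda>_. 0) r 1 i j + t *\<^sub>R mat_pad n (Suc n) g i j)
      = block n g (\<lambda>_. 0) (\<lambda>j. (1 - t) *\<^sub>R r j) 1"
    unfolding mat_pad_eq_block[OF GL_Mat[OF assms]]
    by (auto simp: block_def fun_eq_iff simp flip: scaleR_left.add)
  then show "(\<lambda>i j. (1 - t) *\<^sub>R block n g (\<lambda>_. 0) r 1 i j + t *\<^sub>R mat_pad n (Suc n) g i j)
      \<in> GL (Suc n) UNIV"
    using block_lower_GL[OF assms, of 1 1] by simp
qed

text \<open>\<open>g\<close> has an invertible lift because it is joined to 1, and the row
  \<open>r\<close> may be lifted entry by entry without affecting invertibility. Since the lift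
  fixes the last unit vector, it can correct a matrix without spoiling where that matrix sends a
  given vector.\<close>

lemma stabilizer_lifts:
  fixes f :: "'a::unital_cstar_algebra \<Rightarrow> 'b::unital_cstar_algebra"
  assumes f: "unital_star_hom f" "surj f" and g: "path_component (GL n UNIV) (mat_one n) g"
  obtains L where "L \<in> GL (Suc n) UNIV" "map_mat f L = block n g (\<lambda>_. 0) r 1"
    "mat_vec (Suc n) L (last_unit n) = last_unit n"
proof -
  obtain G where G: "G \<in> GL n UNIV" "map_mat f G = g" using path_component_lifts_to_GL[OF f g] .
  define s where "s j = inv_into UNIV f (r j)" for j
  have s: "f (s j) = r j" for j using surj_f_inv_f[OF f(2)] by (simp add: s_def)
  let ?L = "block n G (\<lambda>_. 0) s 1"
  show thesis
  proof (rule that[of ?L])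
    show "?L \<in> GL (Suc n) UNIV" using block_lower_GL[OF G(1), of 1 1] by simp
    show "map_mat f ?L = block n g (\<lambda>_. 0) r 1"
      using f(1) by (simp add: block_map hom_zero hom_one G s)
    show "mat_vec (Suc n) ?L (last_unit n) = last_unit n"
      unfolding mat_vec_last_unit by (auto simp: block_def)
  qed
qed

text \<open>The discrepancy between the two images is absorbed on the side of the surjective map:
  with \<open>L\<close> a lift of it, \<open>N\<close> becomes L N if \<gamma> is onto, and
  \<open>M\<close> becomes \<open>L\<^sup>-\<^sup>1 M\<close> if \<delta> is onto.\<close>

lemma compatible_lifts:
  fixes \<delta> :: "'b::unital_cstar_algebra \<Rightarrow> 'd::unital_cstar_algebra"
    and \<gamma> :: "'c::unital_cstar_algebra \<Rightarrow> 'd"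
  assumes \<delta>: "unital_star_hom \<delta>" and \<gamma>: "unital_star_hom \<gamma>" and surj: "surj \<gamma> \<or> surj \<delta>"
    and M: "M \<in> GL (Suc n) UNIV" "mat_vec (Suc n) M b = last_unit n"
    and N: "N \<in> GL (Suc n) UNIV" "mat_vec (Suc n) N c = last_unit n"
    and MN: "map_mat \<delta> M = mat_mult (Suc n) (block n g (\<lambda>_. 0) r 1) (map_mat \<gamma> N)"
    and g: "path_component (GL n UNIV) (mat_one n) g"
  obtains M' N' where "M' \<in> GL (Suc n) UNIV" "mat_vec (Suc n) M' b = last_unit n"
    "N' \<in> GL (Suc n) UNIV" "mat_vec (Suc n) N' c = last_unit n" "map_mat \<delta> M' = map_mat \<gamma> N'"
  using surj
proof
  assume "surj \<gamma>"
  then obtain L where L: "L \<in> GL (Suc n) UNIV" "map_mat \<gamma> L = block n g (\<lambda>_. 0) r 1"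
      "mat_vec (Suc n) L (last_unit n) = last_unit n"
    using stabilizer_lifts[OF \<gamma> _ g] by blast
  show thesis
  proof (rule that[OF M])
    show "mat_mult (Suc n) L N \<in> GL (Suc n) UNIV" using L N by (blast intro: GL_mult_UNIV)
    show "mat_vec (Suc n) (mat_mult (Suc n) L N) c = last_unit n" by (simp add: mat_vec_mat_mult N L)
    show "map_mat \<delta> M = map_mat \<gamma> (mat_mult (Suc n) L N)" by (simp add: map_mat_mult[OF \<gamma>] L MN)
  qed
next
  assume "surj \<delta>"
  then obtain L where L: "L \<in> GL (Suc n) UNIV" "map_mat \<delta> L = block n g (\<lambda>_. 0) r 1"
      "mat_vec (Suc n) L (last_unit n) = last_unit n"
    using stabilizer_lifts[OF \<delta> _ g] by blast
  obtain L' where L': "L' \<in> GL (Suc n) UNIV" "mat_mult (Suc n) L' L = mat_one (Suc n)"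
    using GL_inverse L(1) by blast
  have L'e: "mat_vec (Suc n) L' (last_unit n) = last_unit n"
    by (rule mat_vec_inverse[OF L'(2) L(3) last_unit_Vec])
  have "mat_mult (Suc n) (map_mat \<delta> L') (map_mat \<delta> L) = mat_one (Suc n)"
    by (simp add: L' map_mat_one[OF \<delta>] flip: map_mat_mult[OF \<delta>])
  then have cancel: "mat_mult (Suc n) (map_mat \<delta> L') (map_mat \<delta> M) = map_mat \<gamma> N"
    unfolding MN L(2) by (rule mat_cancel_left) (rule GL_Mat[OF map_mat_GL[OF \<gamma> N(1)]])
  show thesis
  proof (rule that[OF _ _ N])
    show "mat_mult (Suc n) L' M \<in> GL (Suc n) UNIV" using L' M by (blast intro: GL_mult_UNIV)
    show "mat_vec (Suc n) (mat_mult (Suc n) L' M) b = last_unit n" by (simp add: mat_vec_mat_mult M L'e)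
    show "map_mat \<delta> (mat_mult (Suc n) L' M) = map_mat \<gamma> N" by (simp add: map_mat_mult[OF \<delta>] cancel)
  qed
qed

text \<open>The pair of inverses again has entries in the pullback, because the common image over D
  has only one inverse.\<close>

lemma GL_pullback_I:
  assumes \<delta>: "unital_star_hom \<delta>" and \<gamma>: "unital_star_hom \<gamma>"
    and M: "M \<in> GL n UNIV" and N: "N \<in> GL n UNIV" and MN: "map_mat \<delta> M = map_mat \<gamma> N"
  shows "(\<lambda>i j. (M i j, N i j)) \<in> GL n (pullback \<delta> \<gamma>)"
proof -
  obtain M' where M': "M' \<in> GL n UNIV" "mat_mult n M M' = mat_one n" "mat_mult n M' M = mat_one n"
    using GL_inverse M .
  obtain N' where N': "N' \<in> GL n UNIV" "mat_mult n N N' = mat_one n" "mat_mult n N' N = mat_one n"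
    using GL_inverse N .
  have MN': "map_mat \<delta> M' = map_mat \<gamma> N'"
  proof (rule mat_inverse_unique)
    show "mat_mult n (map_mat \<delta> M') (map_mat \<delta> M) = mat_one n"
      by (simp add: M' map_mat_one[OF \<delta>] flip: map_mat_mult[OF \<delta>])
    show "mat_mult n (map_mat \<delta> M) (map_mat \<gamma> N') = mat_one n"
      unfolding MN by (simp add: N' map_mat_one[OF \<gamma>] flip: map_mat_mult[OF \<gamma>])
    show "map_mat \<delta> M' \<in> Mat n UNIV" "map_mat \<gamma> N' \<in> Mat n UNIV"
      by (intro map_mat_Mat \<delta> \<gamma> GL_Mat M' N')+
  qed
  have mult: "mat_mult n (\<lambda>i j. (P i j, Q i j)) (\<lambda>i j. (P' i j, Q' i j)) = mat_one n"
    if "mat_mult n P P' = mat_one n" "mat_mult n Q Q' = mat_one n"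
    for P P' :: "nat \<Rightarrow> nat \<Rightarrow> 'a" and Q Q' :: "nat \<Rightarrow> nat \<Rightarrow> 'c"
  proof (intro ext prod_eqI)
    fix i j
    show "fst (mat_mult n (\<lambda>i j. (P i j, Q i j)) (\<lambda>i j. (P' i j, Q' i j)) i j) = fst (mat_one n i j)"
      using fun_cong[OF fun_cong[OF that(1), of i], of j]
      by (simp add: mat_mult_def fst_sum times_prod_def mat_one_def one_prod_def)
    show "snd (mat_mult n (\<lambda>i j. (P i j, Q i j)) (\<lambda>i j. (P' i j, Q' i j)) i j) = snd (mat_one n i j)"
      using fun_cong[OF fun_cong[OF that(2), of i], of j]
      by (simp add: mat_mult_def snd_sum times_prod_def mat_one_def one_prod_def)
  qed
  have Mat: "(\<lambda>i j. (P i j, Q i j)) \<in> Mat n (pullback \<delta> \<gamma>)"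
    if "P \<in> GL n UNIV" "Q \<in> GL n UNIV" "map_mat \<delta> P = map_mat \<gamma> Q" for P Q
    using GL_Mat[OF that(1)] GL_Mat[OF that(2)] that(3)
    by (auto simp: Mat_def pullback_def zero_prod_def map_mat_def fun_eq_iff)
  show ?thesis
    by (rule GL_I[OF Mat[OF M N MN] Mat[OF M'(1) N'(1) MN'] mult[OF M'(2) N'(2)] mult[OF M'(3) N'(3)]])
qed

lemma Lg_pullback:
  assumes "unital_star_hom \<delta>" "unital_star_hom \<gamma>" "a \<in> Lg n (pullback \<delta> \<gamma>)"
  shows "(\<lambda>i. fst (a i)) \<in> Lg n UNIV" "(\<lambda>i. snd (a i)) \<in> Lg n UNIV"
    "(\<lambda>i. \<delta> (fst (a i))) = (\<lambda>i. \<gamma> (snd (a i)))"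
proof -
  have a: "a \<in> Vec n (pullback \<delta> \<gamma>)" using assms(3) by (simp add: Lg_def)
  have "1 \<in> pullback \<delta> \<gamma>" using assms by (intro pullback_unital_subring)
  then obtain x where "1 = (\<Sum>i<n. x i * a i)" using assms(3) unfolding Lg_def by blast
  then have "(\<Sum>i<n. fst (x i) * fst (a i)) = 1" "(\<Sum>i<n. snd (x i) * snd (a i)) = 1"
    by (simp_all add: prod_eq_iff fst_sum snd_sum times_prod_def one_prod_def)
  moreover have "(\<lambda>i. fst (a i)) \<in> Vec n UNIV" "(\<lambda>i. snd (a i)) \<in> Vec n UNIV"
    using a by (auto simp: Vec_def)
  ultimately show "(\<lambda>i. fst (a i)) \<in> Lg n UNIV" "(\<lambda>i. snd (a i)) \<in> Lg n UNIV"
    by (auto intro: Lg_UNIV_I)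
  show "(\<lambda>i. \<delta> (fst (a i))) = (\<lambda>i. \<gamma> (snd (a i)))"
  proof
    fix i show "\<delta> (fst (a i)) = \<gamma> (snd (a i))"
      using a hom_zero[OF assms(1)] hom_zero[OF assms(2)]
      by (cases "i < n") (auto simp: Vec_def pullback_def case_prod_beta)
  qed
qed

text \<open>\<open>GB\<close> and \<open>GC\<close> are left open so that either the identity
  components or the full groups can be inserted. The premise \<open>corner\<close> isolates the
  argument joining \<open>g\<close> to 1, which differs between the two estimates.\<close>

lemma pullback_transitive:
  fixes \<delta> :: "'b::unital_cstar_algebra \<Rightarrow> 'd::unital_cstar_algebra"
    and \<gamma> :: "'c::unital_cstar_algebra \<Rightarrow> 'd"
  assumes \<delta>: "unital_star_hom \<delta>" and \<gamma>: "unital_star_hom \<gamma>" and surj: "surj \<gamma> \<or> surj \<delta>"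
    and GB: "transitive_on (Suc n) GB (Lg (Suc n) UNIV)" "GB \<subseteq> GL (Suc n) UNIV"
    and GC: "transitive_on (Suc n) GC (Lg (Suc n) UNIV)" "GC \<subseteq> GL (Suc n) UNIV"
    and corner: "\<And>M N g r. \<lbrakk>M \<in> GB; N \<in> GC; g \<in> GL n UNIV;
        map_mat \<delta> M = mat_mult (Suc n) (block n g (\<lambda>_. 0) r 1) (map_mat \<gamma> N)\<rbrakk>
      \<Longrightarrow> path_component (GL n UNIV) (mat_one n) g"
  shows "transitive_on (Suc n) (GL (Suc n) (pullback \<delta> \<gamma>)) (Lg (Suc n) (pullback \<delta> \<gamma>))"
proof -
  let ?A = "pullback \<delta> \<gamma>"
  have to_last: "\<exists>G\<in>GL (Suc n) ?A. mat_vec (Suc n) G a = last_unit n" if a: "a \<in> Lg (Suc n) ?A" for a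
  proof -
    let ?b = "\<lambda>i. fst (a i)" and ?c = "\<lambda>i. snd (a i)"
    note Lg = Lg_pullback[OF \<delta> \<gamma> a]
    obtain M where M: "M \<in> GB" "mat_vec (Suc n) M ?b = last_unit n"
      using GB(1) Lg(1) last_unit_Lg unfolding transitive_on_def by blast
    obtain N where N: "N \<in> GC" "mat_vec (Suc n) N ?c = last_unit n"
      using GC(1) Lg(2) last_unit_Lg unfolding transitive_on_def by blast
    have M_GL: "M \<in> GL (Suc n) UNIV" and N_GL: "N \<in> GL (Suc n) UNIV"
      using M N GB(2) GC(2) by auto
    obtain K where K: "K \<in> GL (Suc n) UNIV" "mat_mult (Suc n) (map_mat \<gamma> N) K = mat_one (Suc n)"
        "mat_mult (Suc n) K (map_mat \<gamma> N) = mat_one (Suc n)"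
      using GL_inverse map_mat_GL[OF \<gamma> N_GL] .
    \<comment> \<open>The common image over D of the two components of \<open>a\<close>.\<close>
    define d where "d = (\<lambda>i. \<delta> (?b i))"
    have d: "d \<in> Vec (Suc n) UNIV"
      using Lg(1) hom_zero[OF \<delta>] by (auto simp: d_def Lg_def Vec_def)
    have Md: "mat_vec (Suc n) (map_mat \<delta> M) d = last_unit n"
      unfolding d_def map_mat_vec[OF \<delta>] M(2) by (auto simp: hom_one[OF \<delta>] hom_zero[OF \<delta>])
    have Nd: "mat_vec (Suc n) (map_mat \<gamma> N) d = last_unit n"
      unfolding d_def Lg(3) map_mat_vec[OF \<gamma>] N(2) by (auto simp: hom_one[OF \<gamma>] hom_zero[OF \<gamma>])
    \<comment> \<open>\<open>K\<close> carries the last unit vector to \<open>d\<close>, and the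
      image of \<open>M\<close> carries \<open>d\<close> back, so \<open>h\<close> fixes it.\<close>
    define h where "h = mat_mult (Suc n) (map_mat \<delta> M) K"
    have "mat_vec (Suc n) K (last_unit n) = d"
      by (rule mat_vec_inverse[OF K(3) Nd d])
    then have "mat_vec (Suc n) h (last_unit n) = last_unit n"
      by (simp add: h_def mat_vec_mat_mult Md)
    moreover have "h \<in> GL (Suc n) UNIV"
      unfolding h_def using map_mat_GL[OF \<delta> M_GL] K(1) by (rule GL_mult_UNIV)
    ultimately obtain g r where g: "g \<in> GL n UNIV" "h = block n g (\<lambda>_. 0) r 1"
      using stabilizer_last_unit by blast
    have "map_mat \<delta> M = mat_mult (Suc n) h (map_mat \<gamma> N)"
      unfolding h_def
      by (rule mat_cancel_right[OF K(3) GL_Mat[OF map_mat_GL[OF \<delta> M_GL]], symmetric])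
    then have MN: "map_mat \<delta> M = mat_mult (Suc n) (block n g (\<lambda>_. 0) r 1) (map_mat \<gamma> N)"
      by (simp add: g)
    obtain M' N' where M': "M' \<in> GL (Suc n) UNIV" "mat_vec (Suc n) M' ?b = last_unit n"
      and N': "N' \<in> GL (Suc n) UNIV" "mat_vec (Suc n) N' ?c = last_unit n"
      and eq: "map_mat \<delta> M' = map_mat \<gamma> N'"
      using compatible_lifts[OF \<delta> \<gamma> surj M_GL M(2) N_GL N(2) MN corner[OF M(1) N(1) g(1) MN]] .
    have "mat_vec (Suc n) (\<lambda>i j. (M' i j, N' i j)) a = last_unit n"
    proof (intro ext prod_eqI)
      fix i
      show "fst (mat_vec (Suc n) (\<lambda>i j. (M' i j, N' i j)) a i) = fst (last_unit n i)"
        using fun_cong[OF M'(2), of i]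
        by (simp add: mat_vec_def fst_sum times_prod_def one_prod_def del: sum.lessThan_Suc)
      show "snd (mat_vec (Suc n) (\<lambda>i j. (M' i j, N' i j)) a i) = snd (last_unit n i)"
        using fun_cong[OF N'(2), of i]
        by (simp add: mat_vec_def snd_sum times_prod_def one_prod_def del: sum.lessThan_Suc)
    qed
    then show ?thesis using GL_pullback_I[OF \<delta> \<gamma> M'(1) N'(1) eq] by blast
  qed
  show ?thesis
    unfolding transitive_on_def
  proof (intro ballI)
    fix a a' assume a: "a \<in> Lg (Suc n) ?A" "a' \<in> Lg (Suc n) ?A"
    obtain G where G: "G \<in> GL (Suc n) ?A" "mat_vec (Suc n) G a = last_unit n"
      using to_last[OF a(1)] by blast
    obtain G' where G': "G' \<in> GL (Suc n) ?A" "mat_vec (Suc n) G' a' = last_unit n"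
      using to_last[OF a(2)] by blast
    \<comment> \<open>Two arbitrary vectors are joined through the last unit vector: first
      \<open>G\<close>, then the inverse of \<open>G'\<close>.\<close>
    obtain K where K: "K \<in> GL (Suc n) ?A" "mat_mult (Suc n) K G' = mat_one (Suc n)"
      using GL_inverse G'(1) by blast
    have "a' \<in> Vec (Suc n) ?A" using a(2) by (simp add: Lg_def)
    then have "mat_vec (Suc n) K (last_unit n) = a'"
      using mat_vec_inverse[OF K(2) G'(2)] by blast
    then have "mat_vec (Suc n) (mat_mult (Suc n) K G) a = a'"
      by (simp add: mat_vec_mat_mult G)
    moreover have "mat_mult (Suc n) K G \<in> GL (Suc n) ?A"
    proof (rule GL_mult)
      show "0 \<in> ?A" by (simp add: pullback_def zero_prod_def hom_zero[OF \<delta>] hom_zero[OF \<gamma>])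
    qed (use pullback_unital_subring[OF \<delta> \<gamma>] K G in auto)
    ultimately show "\<exists>G\<in>GL (Suc n) ?A. mat_vec (Suc n) G a = a'" by blast
  qed
qed

section \<open>Stable ranks of the pullback\<close>

lemma Inf_enat_mem:
  fixes X :: "enat set"
  assumes "X \<noteq> {}" shows "Inf X \<in> X"
  using assms unfolding Inf_enat_def by (auto intro: LeastI)

text \<open>A finite infimum is attained, and the condition on all \<open>m \<ge> n\<close> passes
  to larger \<open>n\<close>. Each rank bound thereby becomes a statement about all sizes from
  \<open>k\<close> on.\<close>

lemma Inf_eventually_le_iff:
  "Inf {enat n | n. n \<ge> 1 \<and> (\<forall>m\<ge>n. P m)} \<le> enat k \<longleftrightarrow> k \<ge> 1 \<and> (\<forall>m\<ge>k. P m)"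
proof
  assume le: "Inf {enat n | n. n \<ge> 1 \<and> (\<forall>m\<ge>n. P m)} \<le> enat k"
  let ?X = "{enat n | n. n \<ge> 1 \<and> (\<forall>m\<ge>n. P m)}"
  from le have "?X \<noteq> {}" by (auto simp: Inf_enat_def simp del: Collect_empty_eq)
  then have "Inf ?X \<in> ?X" by (rule Inf_enat_mem)
  with le show "k \<ge> 1 \<and> (\<forall>m\<ge>k. P m)" by auto
next
  assume "k \<ge> 1 \<and> (\<forall>m\<ge>k. P m)"
  then show "Inf {enat n | n. n \<ge> 1 \<and> (\<forall>m\<ge>n. P m)} \<le> enat k" by (intro Inf_lower) blast
qed

lemma gsr_le_iff: "gsr S \<le> enat k \<longleftrightarrow> k \<ge> 1 \<and> (\<forall>m\<ge>k. transitive_on m (GL m S) (Lg m S))"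
  unfolding gsr_def by (rule Inf_eventually_le_iff)

lemma csr_le_iff: "csr S \<le> enat k \<longleftrightarrow> k \<ge> 1 \<and> (\<forall>m\<ge>k. transitive_on m (GL0 m S) (Lg m S))"
  unfolding csr_def by (rule Inf_eventually_le_iff)

lemma inj0_le_iff: "inj0 S \<le> enat k \<longleftrightarrow> k \<ge> 1 \<and>
    (\<forall>m\<ge>k. inj_on (pi0_map (GL m S) (mat_pad (m - 1) m)) (pi0 (GL (m - 1) S)))"
  unfolding inj0_def by (rule Inf_eventually_le_iff)

text \<open>An infinite maximum bounds everything; a finite one is some \<open>k\<close> that bounds
  all three ranks at once.\<close>

lemma enat_le_Max3I:
  fixes x :: enat
  assumes "\<And>k. a \<le> enat k \<Longrightarrow> b \<le> enat k \<Longrightarrow> c \<le> enat k \<Longrightarrow> x \<le> enat k"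
  shows "x \<le> Max {a, b, c}"
proof (cases "Max {a, b, c}")
  case (enat k)
  have "y \<le> enat k" if "y \<in> {a, b, c}" for y
    using that unfolding enat[symmetric] by (intro Max_ge) auto
  with assms enat show ?thesis by simp
qed simp

theorem theorem2p8:
  fixes \<delta> :: "'b::unital_cstar_algebra \<Rightarrow> 'd::unital_cstar_algebra"
    and \<gamma> :: "'c::unital_cstar_algebra \<Rightarrow> 'd"
  assumes "unital_star_hom \<delta>" and "unital_star_hom \<gamma>"
    and "surj \<gamma> \<or> surj \<delta>"
  shows "gsr (pullback \<delta> \<gamma>)
           \<le> Max {csr (UNIV :: 'b set), csr (UNIV :: 'c set), inj0 (UNIV :: 'd set)} \<and>
         (carrier (K1 (UNIV :: 'd set)) = {\<one>\<^bsub>K1 (UNIV :: 'd set)\<^esub>} \<longrightarrow>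
           gsr (pullback \<delta> \<gamma>)
             \<le> Max {gsr (UNIV :: 'b set), gsr (UNIV :: 'c set), inj0 (UNIV :: 'd set)})"
proof (intro conjI impI enat_le_Max3I)
  note \<delta> = assms(1) and \<gamma> = assms(2)
  fix k
  assume csr: "csr (UNIV :: 'b set) \<le> enat k" "csr (UNIV :: 'c set) \<le> enat k"
    and inj: "inj0 (UNIV :: 'd set) \<le> enat k"
  show "gsr (pullback \<delta> \<gamma>) \<le> enat k"
    unfolding gsr_le_iff
  proof (intro conjI allI impI)
    show "k \<ge> 1" using csr by (simp add: csr_le_iff)
    fix m assume "m \<ge> k"
    \<comment> \<open>The corner block has size \<open>n = m - 1\<close>, and \<open>inj0\<close> at
      index \<open>m\<close> compares exactly the sizes \<open>n\<close> and
      \<open>m\<close>.\<close>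
    then obtain n where m: "m = Suc n" using \<open>k \<ge> 1\<close> by (cases m) auto
    show "transitive_on m (GL m (pullback \<delta> \<gamma>)) (Lg m (pullback \<delta> \<gamma>))"
      unfolding m
    proof (rule pullback_transitive[OF assms])
      show "transitive_on (Suc n) (GL0 (Suc n) UNIV) (Lg (Suc n) (UNIV :: 'b set))"
        "transitive_on (Suc n) (GL0 (Suc n) UNIV) (Lg (Suc n) (UNIV :: 'c set))"
        using csr \<open>m \<ge> k\<close> by (simp_all add: csr_le_iff m)
      show "GL0 (Suc n) (UNIV :: 'b set) \<subseteq> GL (Suc n) UNIV" "GL0 (Suc n) (UNIV :: 'c set) \<subseteq> GL (Suc n) UNIV"
        unfolding GL0_def by (rule connected_component_subset)+
      fix M :: "nat \<Rightarrow> nat \<Rightarrow> 'b" and N :: "nat \<Rightarrow> nat \<Rightarrow> 'c" and g :: "nat \<Rightarrow> nat \<Rightarrow> 'd" and r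
      let ?G = "GL (Suc n) (UNIV :: 'd set)" and ?h = "block n g (\<lambda>_. 0) r 1"
      assume M: "M \<in> GL0 (Suc n) UNIV" and N: "N \<in> GL0 (Suc n) UNIV" and g: "g \<in> GL n UNIV"
        and MN: "map_mat \<delta> M = mat_mult (Suc n) ?h (map_mat \<gamma> N)"
      have \<delta>M: "path_component ?G (mat_one (Suc n)) (map_mat \<delta> M)"
        and \<gamma>N: "path_component ?G (mat_one (Suc n)) (map_mat \<gamma> N)"
        using GL0_path_component \<delta> \<gamma> M N by auto
      obtain K where K: "K \<in> ?G" "mat_mult (Suc n) (map_mat \<gamma> N) K = mat_one (Suc n)"
          "mat_mult (Suc n) K (map_mat \<gamma> N) = mat_one (Suc n)"
        using GL_inverse path_component_mem(2)[OF \<gamma>N] .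
      \<comment> \<open>Left multiplication by \<open>K\<close> turns the path from 1 to the image
        of \<open>N\<close> into one from \<open>K\<close> to 1. Next, right multiplication by
        \<open>K\<close> turns the path from 1 to the image of \<open>M\<close> into one from
        \<open>K\<close> to \<open>?h\<close>.\<close>
      have "path_component ?G K (mat_one (Suc n))"
        using path_component_mult_left[OF \<gamma>N K(1)] K mat_mult_one_right[OF GL_Mat[OF K(1)]] by simp
      moreover have "path_component ?G K ?h"
        using path_component_mult_right[OF \<delta>M K(1)] mat_mult_one_left[OF GL_Mat[OF K(1)]]
          mat_cancel_right[OF K(2) block_Mat] by (simp add: MN)
      ultimately have "path_component ?G (mat_one (Suc n)) (mat_pad n (Suc n) g)"
        using path_component_corner[OF g] by (meson path_component_sym path_component_trans)
      moreover have "inj_on (pi0_map ?G (mat_pad n (Suc n))) (pi0 (GL n (UNIV :: 'd set)))"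
        using inj \<open>m \<ge> k\<close> unfolding inj0_le_iff m by (metis diff_Suc_1)
      ultimately show "path_component (GL n UNIV) (mat_one n) g"
        using inj_pi0_mat_pad_descends g by blast
    qed
  qed
next
  fix k
  assume K1: "carrier (K1 (UNIV :: 'd set)) = {\<one>\<^bsub>K1 (UNIV :: 'd set)\<^esub>}"
    and gsr: "gsr (UNIV :: 'b set) \<le> enat k" "gsr (UNIV :: 'c set) \<le> enat k"
    and inj: "inj0 (UNIV :: 'd set) \<le> enat k"
  show "gsr (pullback \<delta> \<gamma>) \<le> enat k"
    unfolding gsr_le_iff
  proof (intro conjI allI impI)
    show "k \<ge> 1" using gsr by (simp add: gsr_le_iff)
    fix m assume "m \<ge> k"
    then obtain n where m: "m = Suc n" using \<open>k \<ge> 1\<close> by (cases m) auto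
    show "transitive_on m (GL m (pullback \<delta> \<gamma>)) (Lg m (pullback \<delta> \<gamma>))"
      unfolding m
    proof (rule pullback_transitive[OF assms])
      show "transitive_on (Suc n) (GL (Suc n) UNIV) (Lg (Suc n) (UNIV :: 'b set))"
        "transitive_on (Suc n) (GL (Suc n) UNIV) (Lg (Suc n) (UNIV :: 'c set))"
        using gsr \<open>m \<ge> k\<close> by (simp_all add: gsr_le_iff m)
      fix g :: "nat \<Rightarrow> nat \<Rightarrow> 'd" assume g: "g \<in> GL n UNIV"
      \<comment> \<open>Vanishing K1 joins \<open>g\<close> to 1 only after padding to some size
        \<open>l\<close>, over which there is no control.\<close>
      obtain l where "l \<ge> n" "path_component (GL l UNIV) (mat_one l) (mat_pad n l g)"
        using K1_trivial_path_component[OF K1 g] .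
      \<comment> \<open>Every index \<open>Suc l\<close> that occurs on the way down is at least
        \<open>Suc n\<close>, hence at least \<open>k\<close>.\<close>
      moreover have "inj_on (pi0_map (GL (Suc l) UNIV) (mat_pad l (Suc l))) (pi0 (GL l (UNIV :: 'd set)))"
        if "l \<ge> n" for l
        using inj \<open>m \<ge> k\<close> that unfolding inj0_le_iff m by (metis Suc_le_mono diff_Suc_1 order_trans)
      ultimately show "path_component (GL n UNIV) (mat_one n) g"
        using inj_pi0_mat_pad_descends_iterated g by blast
    qed auto
  qed
qed

end
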